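(* Let $n, c \ge 1$, $d_1,\dots,d_c \ge 1$ and $k \ge 0$ be integers with $n-c \ge 2$, and let $(X,D)$ be a generic smooth complete intersection pair in $\mathbb{P}^n$ of type $(d_1,\dots,d_c;k)$. If the total degree satisfies $d = d_1+\cdots+d_c+k \ge 2n-c$, then the interior $X\setminus D$ contains no $\mathbb{A}^1$-curves.
   Context: All varieties are over $\mathbb{C}$. A smooth complete intersection pair of type $(d_1,\dots,d_c;k)$ in $\mathbb{P}^n$ is a pair $(X,D)$ where $X\subset\mathbb{P}^n$ is a complete intersection of hypersurfaces of degrees $d_1,\dots,d_c$, $D\subset X$ is the intersection of $X$ with a hypersurface of degree $k$, and both $X$ and $D$ are smooth; when $k=0$ the boundary $D$ is empty. Its total degree is $d=d_1+\cdots+d_c+k$. Such pairs are parametrized by the open subset $S^\circ$ of smooth pairs in $S=\prod_{i=1}^{c+1}H^0(\mathcal{O}_{\mathbb{P}^n}(d_i))$ (with $d_{c+1}=k$); "generic" means the pair corresponds to a point of $S^\circ$ outside a countable union of proper Zariski-closed subsets. An $\mathbb{A}^1$-curve on the interior $X\setminus D$ is a non-constant morphism $\mathbb{A}^1\to X\setminus D$. *)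

theory Defs
  imports "HOL-Computational_Algebra.Polynomial" "HOL-Library.Countable_Set"
begin

definition monoms :: "nat \<Rightarrow> nat \<Rightarrow> (nat \<Rightarrow> nat) set" where
  "monoms n d = {\<alpha>. (\<forall>i>n. \<alpha> i = 0) \<and> (\<Sum>i\<le>n. \<alpha> i) = d}"

definition hom_eval :: "nat \<Rightarrow> nat \<Rightarrow> ((nat \<Rightarrow> nat) \<Rightarrow> complex) \<Rightarrow> (nat \<Rightarrow> complex) \<Rightarrow> complex" where
  "hom_eval n d F x = (\<Sum>\<alpha>\<in>monoms n d. F \<alpha> * (\<Prod>l\<le>n. x l ^ \<alpha> l))"

definition hom_deriv_eval :: "nat \<Rightarrow> nat \<Rightarrow> ((nat \<Rightarrow> nat) \<Rightarrow> complex) \<Rightarrow> nat \<Rightarrow> (nat \<Rightarrow> complex) \<Rightarrow> complex" where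
  "hom_deriv_eval n d F i x =
     (\<Sum>\<alpha>\<in>monoms n d. F \<alpha> * of_nat (\<alpha> i) *
        (\<Prod>l\<le>n. x l ^ (if l = i then \<alpha> l - 1 else \<alpha> l)))"

text \<open>Degree of the j-th equation: d_1..d_c for j < c, and k for j = c (the boundary).\<close>
definition degs :: "nat list \<Rightarrow> nat \<Rightarrow> nat \<Rightarrow> nat" where
  "degs ds k j = (if j < length ds then ds ! j else k)"

text \<open>Parameter space S = prod_{j=1}^{c+1} H^0(O(d_j)), as coefficient families
  s j \<alpha> (j \<le> c, \<alpha> a monomial of degree degs j), zero elsewhere.\<close>
definition param_space :: "nat \<Rightarrow> nat list \<Rightarrow> nat \<Rightarrow> (nat \<Rightarrow> (nat \<Rightarrow> nat) \<Rightarrow> complex) set" where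
  "param_space n ds k = {s. \<forall>j \<alpha>. s j \<alpha> \<noteq> 0 \<longrightarrow> j \<le> length ds \<and> \<alpha> \<in> monoms n (degs ds k j)}"

text \<open>Points of the affine cone over P^n: nonzero vectors (coordinates 0..n).\<close>
definition nonzero_pt :: "nat \<Rightarrow> (nat \<Rightarrow> complex) \<Rightarrow> bool" where
  "nonzero_pt n x \<longleftrightarrow> (\<exists>i\<le>n. x i \<noteq> 0)"

definition in_X :: "nat \<Rightarrow> nat list \<Rightarrow> nat \<Rightarrow> (nat \<Rightarrow> (nat \<Rightarrow> nat) \<Rightarrow> complex) \<Rightarrow> (nat \<Rightarrow> complex) \<Rightarrow> bool" where
  "in_X n ds k s x \<longleftrightarrow> nonzero_pt n x \<and> (\<forall>j<length ds. hom_eval n (degs ds k j) (s j) x = 0)"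

definition in_D :: "nat \<Rightarrow> nat list \<Rightarrow> nat \<Rightarrow> (nat \<Rightarrow> (nat \<Rightarrow> nat) \<Rightarrow> complex) \<Rightarrow> (nat \<Rightarrow> complex) \<Rightarrow> bool" where
  "in_D n ds k s x \<longleftrightarrow> in_X n ds k s x \<and> hom_eval n k (s (length ds)) x = 0"

definition jac_full_rank :: "nat \<Rightarrow> nat list \<Rightarrow> nat \<Rightarrow> (nat \<Rightarrow> (nat \<Rightarrow> nat) \<Rightarrow> complex) \<Rightarrow> nat \<Rightarrow> (nat \<Rightarrow> complex) \<Rightarrow> bool" where
  "jac_full_rank n ds k s m x \<longleftrightarrow>
     (\<forall>lam :: nat \<Rightarrow> complex.
        (\<forall>i\<le>n. (\<Sum>j<m. lam j * hom_deriv_eval n (degs ds k j) (s j) i x) = 0)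
        \<longrightarrow> (\<forall>j<m. lam j = 0))"

text \<open>Smooth pair (Jacobian criterion): X smooth complete intersection of codim c and
  D = X \<inter> {G = 0} smooth of codim c+1.\<close>
definition smooth_pair :: "nat \<Rightarrow> nat list \<Rightarrow> nat \<Rightarrow> (nat \<Rightarrow> (nat \<Rightarrow> nat) \<Rightarrow> complex) \<Rightarrow> bool" where
  "smooth_pair n ds k s \<longleftrightarrow>
     (\<forall>x. in_X n ds k s x \<longrightarrow> jac_full_rank n ds k s (length ds) x) \<and>
     (\<forall>x. in_D n ds k s x \<longrightarrow> jac_full_rank n ds k s (Suc (length ds)) x)"

inductive_set polyfun :: "((nat \<Rightarrow> (nat \<Rightarrow> nat) \<Rightarrow> complex) \<Rightarrow> complex) set" where
  const: "(\<lambda>s. c) \<in> polyfun"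
| coord: "(\<lambda>s. s j \<alpha>) \<in> polyfun"
| add: "p \<in> polyfun \<Longrightarrow> q \<in> polyfun \<Longrightarrow> (\<lambda>s. p s + q s) \<in> polyfun"
| mult: "p \<in> polyfun \<Longrightarrow> q \<in> polyfun \<Longrightarrow> (\<lambda>s. p s * q s) \<in> polyfun"

definition zariski_closed_in :: "(nat \<Rightarrow> (nat \<Rightarrow> nat) \<Rightarrow> complex) set \<Rightarrow> (nat \<Rightarrow> (nat \<Rightarrow> nat) \<Rightarrow> complex) set \<Rightarrow> bool" where
  "zariski_closed_in S Z \<longleftrightarrow> (\<exists>P \<subseteq> polyfun. Z = {s\<in>S. \<forall>p\<in>P. p s = 0})"

text \<open>An A^1-curve in X \ D: a non-constant morphism A^1 \<rightarrow> P^n, given by polynomials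
  f_0..f_n without common zero, landing in X \ D.\<close>
definition A1_curve :: "nat \<Rightarrow> nat list \<Rightarrow> nat \<Rightarrow> (nat \<Rightarrow> (nat \<Rightarrow> nat) \<Rightarrow> complex) \<Rightarrow> (nat \<Rightarrow> complex poly) \<Rightarrow> bool" where
  "A1_curve n ds k s f \<longleftrightarrow>
     (\<forall>t. nonzero_pt n (\<lambda>i. poly (f i) t)) \<and>
     (\<forall>t. in_X n ds k s (\<lambda>i. poly (f i) t) \<and> \<not> in_D n ds k s (\<lambda>i. poly (f i) t)) \<and>
     (\<exists>t1 t2. \<not> (\<exists>\<mu>. \<mu> \<noteq> 0 \<and> (\<forall>i\<le>n. poly (f i) t2 = \<mu> * poly (f i) t1)))"

end

theory Submission
  imports Defs "HOL-Library.Countable" "HOL-Computational_Algebra.Fundamental_Theorem_Algebra"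
    Jordan_Normal_Form.Determinant
begin

text \<open>
  The exceptional sets are the zero loci of the integer polynomials on \<open>S\<close>, so that the coefficients
  of a pair outside them are algebraically independent over the rationals. Every tangent vector \<open>v\<close>
  of \<open>S\<close> then extends to a derivation of the complex numbers that sends \<open>s\<close> to \<open>v\<close>; applied to the
  coefficients of a curve \<open>f\<close> of degree \<open>e\<close> it yields a first order deformation of \<open>f\<close> along \<open>v\<close>. This
  replaces generic smoothness of the family of curves.

  Combining these deformations with coefficients linear in \<open>f\<close>, as in the argument of Clemens, Ein and
  Voisin, one sees that at each point of the line the kernel of the Jacobian \<open>J\<close> of the equations along
  \<open>f\<close> is spanned by polynomial vectors of degree at most \<open>2 e\<close> in the kernel. The kernel also contains
  \<open>f'\<close>, because the boundary equation is constant along \<open>f\<close>, and \<open>f\<close> itself if \<open>k = 0\<close>. Smoothness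
  of \<open>X\<close> along \<open>f\<close> and of \<open>D\<close> (or \<open>X\<close>) at infinity makes the maximal minors of \<open>J\<close> coprime of degree
  exactly \<open>e (d - c - 1)\<close> (or \<open>e (d - c)\<close>), and comparing them with the minors of a kernel basis gives
  \<open>e (2 n - c - d) \<ge> 1\<close>.
\<close>

section \<open>Determinants and degrees of polynomial matrices\<close>

text \<open>Matrices are plain functions on indices below \<open>N\<close>, so that rows can be
  replaced and blocks shifted without carrier conditions.\<close>

definition fdet :: "nat \<Rightarrow> (nat \<Rightarrow> nat \<Rightarrow> 'a) \<Rightarrow> 'a::comm_ring_1" where
  "fdet N M = det (mat N N (\<lambda>(i, j). M i j))"

lemma fdet_cong:
  assumes "\<And>i j. i < N \<Longrightarrow> j < N \<Longrightarrow> A i j = B i j"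
  shows "fdet N A = fdet N B"
  unfolding fdet_def by (intro arg_cong[where f = det] eq_matI) (auto simp: assms)

lemma fdet_mult: "fdet N A * fdet N B = fdet N (\<lambda>i j. \<Sum>k<N. A i k * B k j)"
proof -
  have "fdet N A * fdet N B =
      det (mat N N (\<lambda>(i, j). A i j) * mat N N (\<lambda>(i, j). B i j))"
    unfolding fdet_def by (rule det_mult[symmetric]) auto
  also have "mat N N (\<lambda>(i, j). A i j) * mat N N (\<lambda>(i, j). B i j) =
      mat N N (\<lambda>(i, j). \<Sum>k<N. A i k * B k j)"
    by (rule eq_matI) (auto simp: scalar_prod_def lessThan_atLeast0 intro!: sum.cong)
  finally show ?thesis unfolding fdet_def .
qed

lemma fdet_transpose: "fdet N (\<lambda>i j. A j i) = fdet N A"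
proof -
  have "mat N N (\<lambda>(i, j). A j i) = transpose_mat (mat N N (\<lambda>(i, j). A i j))"
    by (rule eq_matI) auto
  then show ?thesis
    unfolding fdet_def by (simp add: det_transpose[of _ N])
qed

lemma fdet_block:
  fixes M :: "nat \<Rightarrow> nat \<Rightarrow> 'a::idom"
  assumes "\<And>i j. i < p \<Longrightarrow> j < r \<Longrightarrow> M i (p + j) = 0"
  shows "fdet (p + r) M = fdet p M * fdet r (\<lambda>i j. M (p + i) (p + j))"
proof -
  have "mat (p + r) (p + r) (\<lambda>(i, j). M i j) =
      four_block_mat (mat p p (\<lambda>(i, j). M i j)) (0\<^sub>m p r)
        (mat r p (\<lambda>(i, j). M (p + i) j)) (mat r r (\<lambda>(i, j). M (p + i) (p + j)))"
    proof (rule eq_matI)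
    fix i j
    assume "i < dim_row (four_block_mat (mat p p (\<lambda>(i, j). M i j)) (0\<^sub>m p r)
        (mat r p (\<lambda>(i, j). M (p + i) j)) (mat r r (\<lambda>(i, j). M (p + i) (p + j))))"
      and "j < dim_col (four_block_mat (mat p p (\<lambda>(i, j). M i j)) (0\<^sub>m p r)
        (mat r p (\<lambda>(i, j). M (p + i) j)) (mat r r (\<lambda>(i, j). M (p + i) (p + j))))"
    then show "mat (p + r) (p + r) (\<lambda>(i, j). M i j) $$ (i, j) =
        four_block_mat (mat p p (\<lambda>(i, j). M i j)) (0\<^sub>m p r)
        (mat r p (\<lambda>(i, j). M (p + i) j)) (mat r r (\<lambda>(i, j). M (p + i) (p + j))) $$ (i, j)"
      using assms[of i "j - p"] by auto
  qed auto
  then show ?thesis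
    unfolding fdet_def by (simp add: det_four_block_mat_upper_right_zero[of _ p _ r])
qed

lemma fdet_eq_0_iff:
  fixes A :: "nat \<Rightarrow> nat \<Rightarrow> 'a::field"
  shows "fdet N A = 0 \<longleftrightarrow> (\<exists>v. (\<exists>i<N. v i \<noteq> 0) \<and> (\<forall>i<N. (\<Sum>j<N. A i j * v j) = 0))"
    (is "_ \<longleftrightarrow> ?R")
proof -
  let ?A = "mat N N (\<lambda>(i, j). A i j)"
  have A: "?A \<in> carrier_mat N N" by auto
  have mv: "?A *\<^sub>v v = vec N (\<lambda>i. \<Sum>j<N. A i j * v $ j)" if "v \<in> carrier_vec N" for v
    using that by (intro eq_vecI) (auto simp: scalar_prod_def lessThan_atLeast0 intro!: sum.cong)
  have "fdet N A = 0 \<longleftrightarrow> (\<exists>v. v \<in> carrier_vec N \<and> v \<noteq> 0\<^sub>v N \<and> ?A *\<^sub>v v = 0\<^sub>v N)"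
    unfolding fdet_def by (rule det_0_iff_vec_prod_zero_field[OF A])
  also have "\<dots> \<longleftrightarrow> ?R"
  proof
    assume "\<exists>v. v \<in> carrier_vec N \<and> v \<noteq> 0\<^sub>v N \<and> ?A *\<^sub>v v = 0\<^sub>v N"
    then obtain v where v: "v \<in> carrier_vec N" "v \<noteq> 0\<^sub>v N" "?A *\<^sub>v v = 0\<^sub>v N" by blast
    have "\<exists>i<N. v $ i \<noteq> 0" using v(1,2) by (metis eq_vecI carrier_vecD index_zero_vec)
    moreover have "(\<Sum>j<N. A i j * v $ j) = 0" if "i < N" for i
      using arg_cong[OF v(3), of "\<lambda>w. w $ i"] that by (simp add: mv[OF v(1)] del: index_mult_mat_vec)
    ultimately show ?R by (intro exI[of _ "\<lambda>i. v $ i"]) auto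
  next
    assume ?R
    then obtain v i where v: "i < N" "v i \<noteq> 0" "\<forall>i<N. (\<Sum>j<N. A i j * v j) = 0" by blast
    have "vec N v \<noteq> 0\<^sub>v N" using v(1,2) by (metis index_vec index_zero_vec(1))
    moreover have "?A *\<^sub>v vec N v = 0\<^sub>v N"
      using v(3) by (subst mv) (auto intro!: eq_vecI)
    ultimately show "\<exists>v. v \<in> carrier_vec N \<and> v \<noteq> 0\<^sub>v N \<and> ?A *\<^sub>v v = 0\<^sub>v N"
      by (intro exI[of _ "vec N v"]) auto
  qed
  finally show ?thesis .
qed

lemma fdet_solve:
  fixes A :: "nat \<Rightarrow> nat \<Rightarrow> 'a::field"
  assumes "fdet N A \<noteq> 0"
  shows "\<exists>x. \<forall>i<N. (\<Sum>j<N. A i j * x j) = b i"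
proof -
  let ?A = "mat N N (\<lambda>(i, j). A i j)"
  have A: "?A \<in> carrier_mat N N" by auto
  obtain B where B: "B \<in> carrier_mat N N" "?A * B = 1\<^sub>m N"
    using assms det_non_zero_imp_unit[OF A, of "()"] unfolding fdet_def Units_def ring_mat_def
    by auto
  define x where "x = B *\<^sub>v vec N b"
  have x: "x \<in> carrier_vec N" using B(1) unfolding x_def by auto
  have "?A *\<^sub>v x = vec N b"
    unfolding x_def using B by (subst assoc_mult_mat_vec[symmetric, OF A B(1)]) auto
  then have "(?A *\<^sub>v x) $ i = b i" if "i < N" for i using that by simp
  then have "(\<Sum>j<N. A i j * x $ j) = b i" if "i < N" for i
    using that x by (auto simp: scalar_prod_def lessThan_atLeast0)
  then show ?thesis by (intro exI[of _ "\<lambda>j. x $ j"]) auto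
qed

section \<open>Determinants of polynomial matrices and their top coefficients\<close>

lemma poly_fdet: "poly (fdet N M) t = fdet N (\<lambda>i j. poly (M i j) t)"
proof -
  interpret comm_ring_hom "\<lambda>q. poly q t" by unfold_locales auto
  have "map_mat (\<lambda>q. poly q t) (mat N N (\<lambda>(i, j). M i j)) = mat N N (\<lambda>(i, j). poly (M i j) t)"
    by (rule eq_matI) auto
  then show ?thesis unfolding fdet_def by (simp flip: hom_det)
qed

text \<open>The bound \<open>a\<close> need not be attained: \<open>coeff q a\<close> is the value
  at infinity of \<open>q\<close> read as a form of degree \<open>a\<close>, and such values
  multiply even if they vanish.\<close>

lemma coeff_mult_at_degree_bounds:
  assumes "degree q \<le> a" "degree q' \<le> b"
  shows "coeff (q * q') (a + b) = coeff q a * coeff q' b"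
proof -
  have "coeff (q * q') (a + b) = (\<Sum>i\<le>a + b. coeff q i * coeff q' (a + b - i))"
    by (simp add: coeff_mult)
  also have "\<dots> = (\<Sum>i\<in>{a}. coeff q i * coeff q' (a + b - i))"
  proof (rule sum.mono_neutral_right)
    show "\<forall>i\<in>{..a + b} - {a}. coeff q i * coeff q' (a + b - i) = 0"
    proof
      fix i assume "i \<in> {..a + b} - {a}"
      then have "i > a \<or> a + b - i > b" by auto
      then show "coeff q i * coeff q' (a + b - i) = 0"
        using assms by (auto simp: coeff_eq_0)
    qed
  qed auto
  finally show ?thesis by simp
qed

lemma degree_prod_sum_bound:
  assumes "finite I" "\<And>i. i \<in> I \<Longrightarrow> degree (q i) \<le> a i"
  shows "degree (\<Prod>i\<in>I. q i) \<le> (\<Sum>i\<in>I. a i)"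
  using assms
  by (induction I rule: finite_induct) (auto intro!: order.trans[OF degree_mult_le] add_mono)

lemma coeff_prod_at_degree_bounds:
  assumes "finite I" "\<And>i. i \<in> I \<Longrightarrow> degree (q i) \<le> a i"
  shows "coeff (\<Prod>i\<in>I. q i) (\<Sum>i\<in>I. a i) = (\<Prod>i\<in>I. coeff (q i) (a i))"
  using assms
proof (induction I rule: finite_induct)
  case (insert i I)
  then show ?case
    using degree_prod_sum_bound[of I q a]
    by (simp add: coeff_mult_at_degree_bounds)
qed simp

lemma fdet_leibniz:
  "fdet N M = (\<Sum>\<pi> | \<pi> permutes {0..<N}. signof \<pi> * (\<Prod>i<N. M i (\<pi> i)))"
  unfolding fdet_def lessThan_atLeast0
  by (subst det_def'[of _ N]) (auto intro!: sum.cong prod.cong dest: permutes_in_image)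

lemma degree_fdet_le:
  assumes "\<And>i j. i < N \<Longrightarrow> j < N \<Longrightarrow> degree (M i j) \<le> a i"
  shows "degree (fdet N M) \<le> (\<Sum>i<N. a i)"
  unfolding fdet_leibniz
proof (rule degree_sum_le)
  fix \<pi> assume "\<pi> \<in> {\<pi>. \<pi> permutes {0..<N}}"
  then have "degree (\<Prod>i<N. M i (\<pi> i)) \<le> (\<Sum>i<N. a i)"
    by (intro degree_prod_sum_bound) (auto intro!: assms dest: permutes_in_image)
  then show "degree (signof \<pi> * (\<Prod>i<N. M i (\<pi> i))) \<le> (\<Sum>i<N. a i)"
    by (auto simp: sign_def)
qed (simp add: finite_permutations)

text \<open>Every term of the Leibniz expansion takes one entry from each row, so its degree bound
  is always the sum of the row bounds, and the determinant at infinity is the determinant of the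
  values at infinity.\<close>

lemma coeff_fdet:
  assumes "\<And>i j. i < N \<Longrightarrow> j < N \<Longrightarrow> degree (M i j) \<le> a i"
  shows "coeff (fdet N M) (\<Sum>i<N. a i) = fdet N (\<lambda>i j. coeff (M i j) (a i))"
  unfolding fdet_leibniz coeff_sum
proof (rule sum.cong)
  fix \<pi> assume "\<pi> \<in> {\<pi>. \<pi> permutes {0..<N}}"
  then have "coeff (\<Prod>i<N. M i (\<pi> i)) (\<Sum>i<N. a i) = (\<Prod>i<N. coeff (M i (\<pi> i)) (a i))"
    by (intro coeff_prod_at_degree_bounds) (auto intro!: assms dest: permutes_in_image)
  then show "coeff (signof \<pi> * (\<Prod>i<N. M i (\<pi> i))) (\<Sum>i<N. a i) =
      signof \<pi> * (\<Prod>i<N. coeff (M i (\<pi> i)) (a i))"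
    by (auto simp: sign_def)
qed simp

lemma fdet_one: "fdet N (\<lambda>i j. if i = j then 1 else 0) = (1::'a::comm_ring_1)"
proof -
  have "mat N N (\<lambda>(i, j). if i = j then 1 else 0) = (1\<^sub>m N :: 'a mat)" by (rule eq_matI) auto
  then show ?thesis unfolding fdet_def by simp
qed

section \<open>Completing independent rows to an invertible matrix\<close>

definition indep_rows :: "nat \<Rightarrow> nat \<Rightarrow> (nat \<Rightarrow> nat \<Rightarrow> 'a::field) \<Rightarrow> bool" where
  "indep_rows p N w \<longleftrightarrow> (\<forall>y. (\<forall>i<N. (\<Sum>l<p. y l * w l i) = 0) \<longrightarrow> (\<forall>l<p. y l = 0))"

text \<open>If no row could be appended, each unit vector would be a combination of the first
  \<open>p\<close> rows. The identity would then factor through a matrix \<open>C\<close> whose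
  columns from \<open>p\<close> on vanish, against multiplicativity of the determinant.\<close>

lemma indep_rows_extend:
  fixes w :: "nat \<Rightarrow> nat \<Rightarrow> 'a::field"
  assumes "p < N" "indep_rows p N w"
  shows "\<exists>v. indep_rows (Suc p) N (w(p := v))"
proof (rule ccontr)
  assume no: "\<not> ?thesis"
  have "\<exists>c. \<forall>i<N. (\<Sum>l<p. c l * w l i) = (if j = i then 1 else 0)" for j
  proof -
    let ?v = "\<lambda>i. if j = i then 1 else (0::'a)"
    obtain y where y: "\<forall>i<N. (\<Sum>l<Suc p. y l * (w(p := ?v)) l i) = 0" "\<not> (\<forall>l<Suc p. y l = 0)"
      using no unfolding indep_rows_def by blast
    have y': "(\<Sum>l<p. y l * w l i) = - y p * ?v i" if "i < N" for i
    proof -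
      have "(\<Sum>l<p. y l * (w(p := ?v)) l i) = (\<Sum>l<p. y l * w l i)" by (rule sum.cong) auto
      then have "(\<Sum>l<p. y l * w l i) + y p * ?v i = 0" using y(1) that by simp
      then show ?thesis by (simp only: eq_neg_iff_add_eq_0 mult_minus_left)
    qed
    have "y p \<noteq> 0"
    proof
      assume 0: "y p = 0"
      then have "\<forall>i<N. (\<Sum>l<p. y l * w l i) = 0" using y' by simp
      then have "\<forall>l<p. y l = 0" using assms(2) unfolding indep_rows_def by blast
      then show False using y(2) 0 less_Suc_eq by auto
    qed
    have "(\<Sum>l<p. (y l * d) * w l i) = ?v i" if "i < N" "d = - inverse (y p)" for i d
    proof -
      have "(\<Sum>l<p. (y l * d) * w l i) = (\<Sum>l<p. y l * w l i) * d"
        unfolding sum_distrib_right by (rule sum.cong) (simp_all only: mult_ac)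
      then show ?thesis using y'[OF that(1)] \<open>y p \<noteq> 0\<close> that(2) by simp
    qed
    then show ?thesis by (intro exI[of _ "\<lambda>l. y l * - inverse (y p)"]) auto
  qed
  then have "\<exists>c. \<forall>j. \<forall>i<N. (\<Sum>l<p. c j l * w l i) = (if j = i then 1 else 0)"
    by (intro choice allI)
  then obtain c where c: "\<And>j i. i < N \<Longrightarrow> (\<Sum>l<p. c j l * w l i) = (if j = i then 1 else 0)"
    by blast
  \<comment> \<open>The rows of \<open>w\<close> from \<open>p\<close> on are arbitrary; the zero
    columns of \<open>C\<close> mask them.\<close>
  define C where "C = (\<lambda>i k. if k < p then c i k else 0)"
  have "fdet N C * fdet N w = fdet N (\<lambda>i j. if i = j then 1 else 0)"
    unfolding fdet_mult
  proof (rule fdet_cong)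
    fix i j assume "i < N" "j < N"
    have "(\<Sum>k<N. C i k * w k j) = (\<Sum>k<p. c i k * w k j)"
      using \<open>p < N\<close> unfolding C_def by (intro sum.mono_neutral_cong_right) auto
    then show "(\<Sum>k<N. C i k * w k j) = (if i = j then 1 else 0)" using c \<open>j < N\<close> by simp
  qed
  moreover have "fdet N C = 0"
    unfolding fdet_eq_0_iff C_def using \<open>p < N\<close>
    by (intro exI[of _ "\<lambda>k. if k = p then 1 else 0"]) (auto intro!: sum.neutral)
  ultimately show False by (simp add: fdet_one)
qed

lemma indep_rows_completion:
  fixes w :: "nat \<Rightarrow> nat \<Rightarrow> 'a::field"
  assumes "p \<le> N" "indep_rows p N w"
  shows "\<exists>M. fdet N M \<noteq> 0 \<and> (\<forall>l<p. M l = w l)"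
  using assms
proof (induction "N - p" arbitrary: p w)
  case 0
  then have "p = N" by simp
  have "fdet N w \<noteq> 0"
  proof
    assume "fdet N w = 0"
    then have "fdet N (\<lambda>i j. w j i) = 0" by (rule trans[OF fdet_transpose])
    then obtain v i where v: "i < N" "v i \<noteq> 0" "\<forall>i<N. (\<Sum>j<N. w j i * v j) = 0"
      unfolding fdet_eq_0_iff by blast
    then have "\<forall>i<N. (\<Sum>j<N. v j * w j i) = 0" by (simp add: mult.commute[of "v _"])
    then show False using 0(3) v(1,2) unfolding indep_rows_def \<open>p = N\<close> by blast
  qed
  then show ?case by blast
next
  case (Suc d)
  then have "p < N" by simp
  then obtain v where "indep_rows (Suc p) N (w(p := v))" using indep_rows_extend Suc.prems by blast
  with Suc.hyps(1)[of "Suc p" "w(p := v)"] Suc.hyps(2) \<open>p < N\<close>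
  obtain M where "fdet N M \<noteq> 0" "\<forall>l<Suc p. M l = (w(p := v)) l" by force
  then show ?case by (intro exI[of _ M]) auto
qed

text \<open>The hypothesis says that \<open>Q\<close> divides \<open>P\<close> in the local ring at
  every point. At a root \<open>a\<close> of \<open>Q\<close> it forces \<open>P\<close> to vanish
  too, as \<open>k\<close> is a unit there; cancelling the common factor lowers the degree of
  \<open>Q\<close>.\<close>

lemma poly_dvd_locally:
  fixes Q P :: "complex poly"
  assumes "Q \<noteq> 0" "\<And>t. \<exists>h k. Q * h = P * k \<and> poly k t \<noteq> 0"
  shows "Q dvd P"
  using assms
proof (induction "degree Q" arbitrary: Q P)
  case 0
  then show ?case by (simp add: is_unit_iff_degree unit_imp_dvd)
next
  case (Suc d)
  then have "\<not> constant (poly Q)" by (simp add: constant_degree)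
  then obtain a where a: "poly Q a = 0" using fundamental_theorem_of_algebra by blast
  obtain h k where "Q * h = P * k" "poly k a \<noteq> 0" using Suc.prems(2) by blast
  then have "poly P a * poly k a = 0" using a by (auto dest: arg_cong[of _ _ "\<lambda>u. poly u a"])
  then have "poly P a = 0" using \<open>poly k a \<noteq> 0\<close> by simp
  then obtain P' Q' where PQ: "P = [:-a, 1:] * P'" "Q = [:-a, 1:] * Q'"
    using a by (meson dvdE poly_eq_0_iff_dvd)
  have "Q' \<noteq> 0" using Suc.prems(1) PQ by auto
  have "degree Q = Suc (degree Q')" unfolding PQ using \<open>Q' \<noteq> 0\<close> by (subst degree_mult_eq) auto
  moreover have "\<exists>h k. Q' * h = P' * k \<and> poly k t \<noteq> 0" for t
  proof -
    obtain h k where hk: "Q * h = P * k" "poly k t \<noteq> 0" using Suc.prems(2) by blast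
    then have "[:-a, 1:] * (Q' * h) = [:-a, 1:] * (P' * k)" unfolding PQ by (simp only: mult.assoc)
    then have "Q' * h = P' * k" by (subst (asm) mult_left_cancel) auto
    then show ?thesis using hk(2) by blast
  qed
  ultimately have "Q' dvd P'" using Suc.hyps \<open>Q' \<noteq> 0\<close> by auto
  then show ?case unfolding PQ by (rule mult_dvd_mono[OF dvd_refl])
qed

text \<open>
  Complete \<open>J\<close> by constant rows \<open>E\<close> that are generic at infinity, and let \<open>A\<close> consist of \<open>r\<close> columns
  of the kernel of \<open>J\<close>, beginning with \<open>W\<close> and chosen independent at one point. If \<open>R\<close> is a constant
  right inverse of \<open>J t\<close>, the block identity \<open>[J; E] [R | A] = [J R, 0; E R, E A]\<close> shows that
  \<open>det [J; E]\<close> divides \<open>det (E A)\<close> locally at \<open>t\<close>, hence globally. The first determinant has degree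
  exactly \<open>\<Sum>l<p. a l\<close>, and the second is bounded by the column degrees of \<open>A\<close>.
\<close>

lemma kernel_degree_bound:
  fixes J W :: "nat \<Rightarrow> nat \<Rightarrow> complex poly"
  assumes N: "N = p + r" and "q \<le> r"
    and degJ: "\<And>l i. l < p \<Longrightarrow> i < N \<Longrightarrow> degree (J l i) \<le> a l"
    and full: "\<And>t. indep_rows p N (\<lambda>l i. poly (J l i) t)"
    and inf: "indep_rows p N (\<lambda>l i. coeff (J l i) (a l))"
    and JW: "\<And>l j. l < p \<Longrightarrow> j < q \<Longrightarrow> (\<Sum>i<N. J l i * W j i) = 0"
    and degW: "\<And>j i. j < q \<Longrightarrow> i < N \<Longrightarrow> degree (W j i) \<le> b j"
    and "g \<noteq> 0" and indW: "\<And>t. poly g t \<noteq> 0 \<Longrightarrow> indep_rows q N (\<lambda>j i. poly (W j i) t)"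
    and ext: "\<And>t x. (\<And>l. l < p \<Longrightarrow> (\<Sum>i<N. poly (J l i) t * x i) = 0) \<Longrightarrow>
        \<exists>u. (\<forall>i<N. degree (u i) \<le> m) \<and> (\<forall>l<p. (\<Sum>i<N. J l i * u i) = 0) \<and>
            (\<forall>i<N. poly (u i) t = x i)"
  shows "(\<Sum>l<p. a l) \<le> (\<Sum>j<q. b j) + (r - q) * m"
proof -
  have "p \<le> N" using N by simp
  obtain E where E: "fdet N E \<noteq> 0" "\<And>l. l < p \<Longrightarrow> E l = (\<lambda>i. coeff (J l i) (a l))"
    using indep_rows_completion[OF \<open>p \<le> N\<close> inf] by auto
  \<comment> \<open>The constant rows carry the bound 0 in \<open>a'\<close>, so the coefficient of
    \<open>Q\<close> at \<open>\<Sum>l<p. a l\<close> is the nonzero determinant of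
    \<open>E\<close>.\<close>
  define S where "S = (\<lambda>i j. if i < p then J i j else [:E i j:])"
  define a' where "a' = (\<lambda>i. if i < p then a i else 0)"
  define Q where "Q = fdet N S"
  have sum_a': "(\<Sum>i<N. a' i) = (\<Sum>l<p. a l)"
    unfolding a'_def using N by (intro sum.mono_neutral_cong_right) auto
  have "coeff Q (\<Sum>i<N. a' i) = fdet N (\<lambda>i j. coeff (S i j) (a' i))"
    unfolding Q_def by (rule coeff_fdet) (auto simp: S_def a'_def degJ)
  also have "\<dots> = fdet N E" by (rule fdet_cong) (auto simp: S_def a'_def E(2))
  finally have cQ: "coeff Q (\<Sum>l<p. a l) \<noteq> 0" using E(1) sum_a' by simp
  then have "Q \<noteq> 0" by auto
  then have "Q * g \<noteq> 0" using \<open>g \<noteq> 0\<close> by simp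
  then obtain t0 where t0: "poly Q t0 \<noteq> 0" "poly g t0 \<noteq> 0"
    using poly_all_0_iff_0[of "Q * g"] by auto
  have S0: "fdet N (\<lambda>i j. poly (S i j) t0) \<noteq> 0" using t0(1) unfolding Q_def poly_fdet .
  \<comment> \<open>On the kernel of \<open>J\<close> at \<open>t0\<close> the rows of
    \<open>E\<close> from \<open>p\<close> on are linear coordinates, because \<open>S\<close> is
    invertible there; \<open>z\<close> holds the coordinates of the columns
    \<open>W\<close>.\<close>
  define z where "z = (\<lambda>j i. \<Sum>k<N. E (p + i) k * poly (W j k) t0)"
  have "indep_rows q r z"
    unfolding indep_rows_def
  proof (intro allI impI)
    fix y l assume y: "\<forall>i<r. (\<Sum>l<q. y l * z l i) = 0" and "l < q"
    define v where "v = (\<lambda>k. \<Sum>j<q. y j * poly (W j k) t0)"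
    have "(\<Sum>k<N. poly (S i k) t0 * v k) = 0" if "i < N" for i
    proof -
      have swap: "(\<Sum>k<N. poly (S i k) t0 * v k) =
          (\<Sum>j<q. y j * (\<Sum>k<N. poly (S i k) t0 * poly (W j k) t0))"
        unfolding v_def sum_distrib_left by (subst sum.swap) (simp add: mult.left_commute)
      show ?thesis
      proof (cases "i < p")
        case True
        have "(\<Sum>k<N. poly (S i k) t0 * poly (W j k) t0) = 0" if "j < q" for j
          using arg_cong[OF JW[OF True that], of "\<lambda>u. poly u t0"] True
          by (simp add: poly_sum S_def)
        then show ?thesis unfolding swap by simp
      next
        case False
        then obtain i' where i': "i = p + i'" "i' < r" using \<open>i < N\<close> N
          by (metis add_less_cancel_left le_Suc_ex not_less)
        have "(\<Sum>k<N. poly (S i k) t0 * v k) = (\<Sum>l<q. y l * z l i')"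
          unfolding swap by (simp add: S_def z_def i'(1))
        then show ?thesis using y i'(2) by simp
      qed
    qed
    then have "\<forall>k<N. v k = 0" using S0 fdet_eq_0_iff[of N "\<lambda>i j. poly (S i j) t0"] by blast
    then show "y l = 0" using indW[OF t0(2)] \<open>l < q\<close> unfolding indep_rows_def v_def by blast
  qed
  then obtain Y where Y: "fdet r Y \<noteq> 0" "\<And>j. j < q \<Longrightarrow> Y j = z j"
    using indep_rows_completion[OF \<open>q \<le> r\<close>] by blast
  define b' where "b' = (\<lambda>j. if j < q then b j else m)"
  \<comment> \<open>The first \<open>q\<close> columns are \<open>W\<close>. Each further one
    prescribes the coordinates \<open>Y j\<close>, solves for the kernel vector \<open>x\<close> at
    \<open>t0\<close>, and lifts it by \<open>ext\<close>.\<close>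
  have "\<exists>u. (\<forall>i<N. degree (u i) \<le> b' j) \<and> (\<forall>l<p. (\<Sum>i<N. J l i * u i) = 0) \<and>
      (\<forall>i<r. (\<Sum>k<N. E (p + i) k * poly (u k) t0) = Y j i)" for j
  proof (cases "j < q")
    case True
    then show ?thesis by (intro exI[of _ "W j"]) (auto simp: b'_def degW JW Y(2) z_def)
  next
    case False
    obtain x where x: "\<And>i. i < N \<Longrightarrow>
        (\<Sum>k<N. poly (S i k) t0 * x k) = (if i < p then 0 else Y j (i - p))"
      using fdet_solve[OF S0, of "\<lambda>i. if i < p then 0 else Y j (i - p)"] by blast
    have "(\<Sum>i<N. poly (J l i) t0 * x i) = 0" if "l < p" for l
      using x[of l] that N by (simp add: S_def)
    then obtain u where u: "\<forall>i<N. degree (u i) \<le> m" "\<forall>l<p. (\<Sum>i<N. J l i * u i) = 0"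
        "\<forall>i<N. poly (u i) t0 = x i"
      using ext by blast
    have "(\<Sum>k<N. E (p + i) k * poly (u k) t0) = Y j i" if "i < r" for i
      using x[of "p + i"] that N u(3) by (simp add: S_def)
    then show ?thesis using u False by (auto simp: b'_def)
  qed
  then have "\<exists>U. \<forall>j. (\<forall>i<N. degree (U j i) \<le> b' j) \<and>
      (\<forall>l<p. (\<Sum>i<N. J l i * U j i) = 0) \<and>
      (\<forall>i<r. (\<Sum>k<N. E (p + i) k * poly (U j k) t0) = Y j i)"
    by (intro choice allI)
  then obtain U where U: "\<And>j i. i < N \<Longrightarrow> degree (U j i) \<le> b' j"
      "\<And>j l. l < p \<Longrightarrow> (\<Sum>i<N. J l i * U j i) = 0"
      "\<And>j i. i < r \<Longrightarrow> (\<Sum>k<N. E (p + i) k * poly (U j k) t0) = Y j i"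
    by blast
  define P where "P = fdet r (\<lambda>i j. \<Sum>k<N. [:E (p + i) k:] * U j k)"
  have "poly P t0 = fdet r (\<lambda>i j. Y j i)"
    unfolding P_def poly_fdet by (rule fdet_cong) (simp add: poly_sum U(3))
  also have "\<dots> = fdet r Y" by (rule fdet_transpose)
  finally have "poly P t0 \<noteq> 0" using Y(1) by (rule ssubst)
  then have "P \<noteq> 0" by auto
  have "degree P \<le> (\<Sum>j<r. b' j)"
    unfolding P_def
    by (subst fdet_transpose[symmetric], rule degree_fdet_le, rule degree_sum_le)
      (auto intro: order.trans[OF degree_smult_le] U(1))
  also have "(\<Sum>j<r. b' j) = (\<Sum>j<q. b j) + (r - q) * m"
  proof -
    have "{..<r} = {..<q} \<union> {q..<r}" using \<open>q \<le> r\<close> by auto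
    then have "(\<Sum>j<r. b' j) = (\<Sum>j<q. b' j) + (\<Sum>j=q..<r. b' j)"
      by (simp add: sum.union_disjoint ivl_disj_int)
    then show ?thesis by (simp add: b'_def)
  qed
  finally have degP: "degree P \<le> (\<Sum>j<q. b j) + (r - q) * m" .
  have "Q dvd P"
  proof (rule poly_dvd_locally[OF \<open>Q \<noteq> 0\<close>])
    fix t
    \<comment> \<open>Completing the rows of \<open>J\<close> at \<open>t\<close> and inverting
      gives constant columns \<open>R\<close>; the first \<open>p\<close> of them form a right
      inverse of \<open>J\<close> at \<open>t\<close>, whence \<open>K\<close> is 1 there.\<close>
    obtain M where M: "fdet N M \<noteq> 0" "\<And>l. l < p \<Longrightarrow> M l = (\<lambda>i. poly (J l i) t)"
      using indep_rows_completion[OF \<open>p \<le> N\<close> full[of t]] by auto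
    have "\<exists>R. \<forall>j. \<forall>i<N. (\<Sum>k<N. M i k * R j k) = (if i = j then 1 else 0)"
      by (intro choice allI fdet_solve[OF M(1)])
    then obtain R where R: "\<And>j i. i < N \<Longrightarrow> (\<Sum>k<N. M i k * R j k) = (if i = j then 1 else 0)"
      by blast
    define B where "B = (\<lambda>i j. if j < p then [:R j i:] else U (j - p) i)"
    define K where "K = fdet p (\<lambda>i j. \<Sum>k<N. J i k * [:R j k:])"
    have "Q * fdet N B = fdet (p + r) (\<lambda>i j. \<Sum>k<N. S i k * B k j)"
      unfolding Q_def fdet_mult N ..
    also have "\<dots> = fdet p (\<lambda>i j. \<Sum>k<N. S i k * B k j) *
        fdet r (\<lambda>i j. \<Sum>k<N. S (p + i) k * B k (p + j))"
      by (rule fdet_block) (simp add: S_def B_def U(2))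
    also have "fdet p (\<lambda>i j. \<Sum>k<N. S i k * B k j) = K"
      unfolding K_def by (rule fdet_cong) (simp add: S_def B_def)
    also have "fdet r (\<lambda>i j. \<Sum>k<N. S (p + i) k * B k (p + j)) = P"
      unfolding P_def by (rule fdet_cong) (simp add: S_def B_def)
    finally have "Q * fdet N B = P * K" by (simp add: mult.commute)
    moreover have "poly K t = fdet p (\<lambda>i j. if i = j then 1 else 0)"
      unfolding K_def poly_fdet
    proof (rule fdet_cong)
      fix i j assume "i < p" "j < p"
      then show "poly (\<Sum>k<N. J i k * [:R j k:]) t = (if i = j then 1 else 0)"
        using R[of i j] M(2)[of i] N by (simp add: poly_sum mult.commute)
    qed
    ultimately show "\<exists>h k. Q * h = P * k \<and> poly k t \<noteq> 0"
      by (intro exI[of _ "fdet N B"] exI[of _ K]) (simp add: fdet_one)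
  qed
  then have "degree Q \<le> degree P" using \<open>P \<noteq> 0\<close> by (rule dvd_imp_degree_le)
  moreover have "(\<Sum>l<p. a l) \<le> degree Q" using cQ by (rule le_degree)
  ultimately show ?thesis using degP by linarith
qed

section \<open>Extending derivations\<close>

definition derivation :: "('a::comm_ring_1 \<Rightarrow> 'a) \<Rightarrow> bool" where
  "derivation \<delta> \<longleftrightarrow> (\<forall>a b. \<delta> (a + b) = \<delta> a + \<delta> b) \<and> (\<forall>a b. \<delta> (a * b) = a * \<delta> b + \<delta> a * b)"

text \<open>The graph of a derivation on a subring, that is, a subring of the dual numbers \<open>a + x \<epsilon>\<close> in which
  \<open>0\<close> is the only multiple of \<open>\<epsilon>\<close>.\<close>

definition partial_derivation :: "('a::comm_ring_1 \<times> 'a) set \<Rightarrow> bool" where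
  "partial_derivation \<Gamma> \<longleftrightarrow>
     (\<forall>a x b y. (a, x) \<in> \<Gamma> \<longrightarrow> (b, y) \<in> \<Gamma> \<longrightarrow> (a + b, x + y) \<in> \<Gamma> \<and> (a * b, a * y + x * b) \<in> \<Gamma>) \<and>
     (- 1, 0) \<in> \<Gamma> \<and> (\<forall>x. (0, x) \<in> \<Gamma> \<longrightarrow> x = 0)"

text \<open>A pair \<open>(p, q)\<close> stands for the polynomial \<open>p + q \<epsilon>\<close>
  with coefficients in the subring \<Gamma> of the dual numbers.\<close>

definition pd_poly :: "('a::comm_ring_1 \<times> 'a) set \<Rightarrow> ('a poly \<times> 'a poly) set" where
  "pd_poly \<Gamma> = {(p, q). \<forall>i. (coeff p i, coeff q i) \<in> \<Gamma>}"

context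
  fixes \<Gamma> :: "('a::idom \<times> 'a) set"
  assumes \<Gamma>: "partial_derivation \<Gamma>"
begin

lemma pd_add: "(a, x) \<in> \<Gamma> \<Longrightarrow> (b, y) \<in> \<Gamma> \<Longrightarrow> (a + b, x + y) \<in> \<Gamma>"
  and pd_mult: "(a, x) \<in> \<Gamma> \<Longrightarrow> (b, y) \<in> \<Gamma> \<Longrightarrow> (a * b, a * y + x * b) \<in> \<Gamma>"
  and pd_minus_one: "(- 1, 0) \<in> \<Gamma>"
  and pd_zero_unique: "(0, x) \<in> \<Gamma> \<Longrightarrow> x = 0"
  using \<Gamma> unfolding partial_derivation_def by blast+

lemma pd_one: "(1, 0) \<in> \<Gamma>"
  using pd_mult[OF pd_minus_one pd_minus_one] by simp

lemma pd_zero: "(0, 0) \<in> \<Gamma>"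
  using pd_add[OF pd_one pd_minus_one] by simp

lemma pd_uminus: "(a, x) \<in> \<Gamma> \<Longrightarrow> (- a, - x) \<in> \<Gamma>"
  using pd_mult[OF pd_minus_one] by simp

lemma pd_unique:
  assumes "(a, x) \<in> \<Gamma>" "(a, y) \<in> \<Gamma>"
  shows "x = y"
  using pd_zero_unique[of "x - y"] pd_add[OF assms(1) pd_uminus[OF assms(2)]] by simp

lemma pd_of_nat: "(of_nat k, 0) \<in> \<Gamma>"
  by (induction k) (use pd_zero pd_add[OF pd_one] in auto)

lemma pd_sum: "(\<And>i. i \<in> I \<Longrightarrow> (f i, g i) \<in> \<Gamma>) \<Longrightarrow> (\<Sum>i\<in>I. f i, \<Sum>i\<in>I. g i) \<in> \<Gamma>"
  by (induction I rule: infinite_finite_induct) (auto simp: pd_zero pd_add)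

lemma pd_poly_add: "(p, q) \<in> pd_poly \<Gamma> \<Longrightarrow> (p', q') \<in> pd_poly \<Gamma> \<Longrightarrow> (p + p', q + q') \<in> pd_poly \<Gamma>"
  by (auto simp: pd_poly_def pd_add)

lemma pd_poly_uminus: "(p, q) \<in> pd_poly \<Gamma> \<Longrightarrow> (- p, - q) \<in> pd_poly \<Gamma>"
  by (auto simp: pd_poly_def pd_uminus)

lemma pd_poly_mult:
  assumes "(p, q) \<in> pd_poly \<Gamma>" "(p', q') \<in> pd_poly \<Gamma>"
  shows "(p * p', p * q' + q * p') \<in> pd_poly \<Gamma>"
proof -
  have "(coeff (p * p') i, coeff (p * q' + q * p') i) \<in> \<Gamma>" for i
    unfolding coeff_add coeff_mult sum.distrib[symmetric]
    using assms by (intro pd_sum pd_mult) (auto simp: pd_poly_def)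
  then show ?thesis by (simp add: pd_poly_def)
qed

lemma pd_poly_monom: "(a, x) \<in> \<Gamma> \<Longrightarrow> (monom a k, monom x k) \<in> pd_poly \<Gamma>"
  by (auto simp: pd_poly_def pd_zero)

lemma pd_poly_pderiv: "(p, q) \<in> pd_poly \<Gamma> \<Longrightarrow> (pderiv p, pderiv q) \<in> pd_poly \<Gamma>"
  using pd_mult[OF pd_of_nat[of "Suc _"]]
  by (auto simp: pd_poly_def coeff_pderiv simp del: of_nat_Suc)

lemma pd_poly_zero_unique: "(0, q) \<in> pd_poly \<Gamma> \<Longrightarrow> q = 0"
  using pd_zero_unique by (auto simp: pd_poly_def poly_eq_iff)

end

text \<open>Any value \<open>y\<close> works at a transcendental \<open>a\<close>; at an algebraic \<open>a\<close> the relation of minimal degree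
  determines \<open>y\<close>, its derivative being nonzero at \<open>a\<close> in characteristic 0.\<close>

lemma poly_root_derivation:
  fixes a :: "'a::field_char_0"
  assumes \<Gamma>: "partial_derivation \<Gamma>"
  shows "\<exists>y. \<forall>(p, q)\<in>pd_poly \<Gamma>. poly p a = 0 \<longrightarrow> poly q a + y * poly (pderiv p) a = 0"
proof (cases "\<exists>p q. (p, q) \<in> pd_poly \<Gamma> \<and> p \<noteq> 0 \<and> poly p a = 0")
  case False
  then have "(p, q) \<in> pd_poly \<Gamma> \<Longrightarrow> poly p a = 0 \<Longrightarrow> p = 0 \<and> q = 0" for p q
    using pd_poly_zero_unique[OF \<Gamma>] by blast
  then show ?thesis by fastforce
next
  case True
  define R where "R = {p. p \<noteq> 0 \<and> poly p a = 0 \<and> (\<exists>q. (p, q) \<in> pd_poly \<Gamma>)}"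
  obtain p0 where "p0 \<in> R" using True unfolding R_def by blast
  then obtain m where "m \<in> R" and min: "\<And>p. p \<in> R \<Longrightarrow> degree m \<le> degree p"
    using ex_has_least_nat[of "\<lambda>p. p \<in> R" p0 degree] by blast
  then obtain m' where m: "m \<noteq> 0" "poly m a = 0" "(m, m') \<in> pd_poly \<Gamma>" unfolding R_def by blast
  have "degree m \<noteq> 0"
  proof
    assume "degree m = 0"
    then obtain c where "m = [:c:]" by (rule degree_eq_zeroE)
    then show False using m(1,2) by simp
  qed
  have "poly (pderiv m) a \<noteq> 0"
  proof
    assume "poly (pderiv m) a = 0"
    moreover have "pderiv m \<noteq> 0" using \<open>degree m \<noteq> 0\<close> by (simp add: pderiv_eq_0_iff)
    ultimately have "pderiv m \<in> R" using pd_poly_pderiv[OF \<Gamma> m(3)] unfolding R_def by blast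
    then show False using min[of "pderiv m"] \<open>degree m \<noteq> 0\<close> by (simp add: degree_pderiv)
  qed
  \<comment> \<open>The value forced by differentiating the relation \<open>m\<close> at
    \<open>a\<close>.\<close>
  define y where "y = - poly m' a / poly (pderiv m) a"
  have ym: "poly m' a + y * poly (pderiv m) a = 0"
    using \<open>poly (pderiv m) a \<noteq> 0\<close> unfolding y_def by simp
  have "poly q a + y * poly (pderiv p) a = 0" if "(p, q) \<in> pd_poly \<Gamma>" "poly p a = 0" for p q
    using that
  proof (induction "degree p" arbitrary: p q rule: less_induct)
    case less
    show ?case
    proof (cases "p = 0")
      case True
      then show ?thesis using pd_poly_zero_unique[OF \<Gamma>, of q] less.prems(1) by simp
    next
      case False
      then have "degree m \<le> degree p" using less.prems by (intro min) (auto simp: R_def)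
      define k where "k = degree p - degree m"
      define l l' c c' where "l = lead_coeff m" and "l' = coeff m' (degree m)"
        and "c = lead_coeff p" and "c' = coeff q (degree p)"
      have lc: "(l, l') \<in> \<Gamma>" "(c, c') \<in> \<Gamma>"
        using less.prems(1) m(3) unfolding l_def l'_def c_def c'_def pd_poly_def by auto
      \<comment> \<open>one step of pseudo-division of p by m\<close>
      define p2 where "p2 = monom l 0 * p - monom c k * m"
      define q2 where "q2 = (monom l 0 * q + monom l' 0 * p) - (monom c k * m' + monom c' k * m)"
      have "(p2, q2) \<in> pd_poly \<Gamma>"
        unfolding p2_def q2_def diff_conv_add_uminus
        by (intro pd_poly_add[OF \<Gamma>] pd_poly_uminus[OF \<Gamma>] pd_poly_mult[OF \<Gamma>] pd_poly_monom[OF \<Gamma>]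
            lc less.prems(1) m(3))
      moreover have "poly p2 a = 0" using less.prems(2) m(2) unfolding p2_def by simp
      moreover have "degree p2 < degree p"
      proof -
        have "degree p2 \<le> degree p"
          unfolding p2_def using \<open>degree m \<le> degree p\<close> degree_monom_le[of c k] degree_monom_le[of l 0]
          by (intro degree_diff_le order.trans[OF degree_mult_le])
            (auto simp: k_def intro: order.trans[OF add_right_mono])
        moreover have "coeff p2 (degree p) = 0"
          using \<open>degree m \<le> degree p\<close>
          unfolding p2_def l_def c_def k_def by (simp add: coeff_monom_mult)
        moreover have "degree p \<noteq> 0" using \<open>degree m \<le> degree p\<close> \<open>degree m \<noteq> 0\<close> by simp
        ultimately show ?thesis
          by (metis degree_0 le_neq_implies_less leading_coeff_0_iff not_gr_zero)
      qed
      ultimately have "poly q2 a + y * poly (pderiv p2) a = 0" using less.hyps by blast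
      \<comment> \<open>As \<open>p\<close> and \<open>m\<close> both vanish at \<open>a\<close>,
        the terms with \<open>l'\<close>, \<open>c'\<close> and the derivative of the monomial drop
        out.\<close>
      also have "poly q2 a + y * poly (pderiv p2) a =
          l * (poly q a + y * poly (pderiv p) a) - c * a ^ k * (poly m' a + y * poly (pderiv m) a)"
        unfolding p2_def q2_def using less.prems(2) m(2)
        by (simp add: pderiv_diff pderiv_mult poly_monom pderiv_monom algebra_simps)
      finally have "l * (poly q a + y * poly (pderiv p) a) = 0" unfolding ym by simp
      then show ?thesis using m(1) unfolding l_def by simp
    qed
  qed
  then show ?thesis by blast
qed

text \<open>The map \<open>h\<close> evaluates polynomials over the dual subring at
  \<open>a + y \<epsilon>\<close>, which is a ring homomorphism. The choice of \<open>y\<close> from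
  \<open>poly_root_derivation\<close> keeps 0 the only multiple of \<open>\<epsilon>\<close> in its
  image.\<close>

lemma partial_derivation_extend:
  fixes a :: "'a::field_char_0"
  assumes \<Gamma>: "partial_derivation \<Gamma>"
  shows "\<exists>\<Gamma>'. partial_derivation \<Gamma>' \<and> \<Gamma> \<subseteq> \<Gamma>' \<and> (\<exists>y. (a, y) \<in> \<Gamma>')"
proof -
  obtain y where y: "\<And>p q. (p, q) \<in> pd_poly \<Gamma> \<Longrightarrow> poly p a = 0 \<Longrightarrow> poly q a + y * poly (pderiv p) a = 0"
    using poly_root_derivation[OF \<Gamma>, of a] by fast
  define h where "h = (\<lambda>(p, q). (poly p a, poly q a + y * poly (pderiv p) a))"
  define \<Gamma>' where "\<Gamma>' = h ` pd_poly \<Gamma>"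
  have const: "([:b:], [:x:]) \<in> pd_poly \<Gamma>" if "(b, x) \<in> \<Gamma>" for b x
    using pd_poly_monom[OF \<Gamma> that, of 0] by (simp add: monom_0)
  have "partial_derivation \<Gamma>'"
    unfolding partial_derivation_def
  proof (intro conjI allI impI)
    fix b x b' x' assume "(b, x) \<in> \<Gamma>'" "(b', x') \<in> \<Gamma>'"
    then obtain p q p' q' where pq: "(p, q) \<in> pd_poly \<Gamma>" "(p', q') \<in> pd_poly \<Gamma>"
        "(b, x) = h (p, q)" "(b', x') = h (p', q')"
      unfolding \<Gamma>'_def by auto
    have "(b + b', x + x') = h (p + p', q + q')"
      using pq(3,4) by (simp add: h_def pderiv_add algebra_simps)
    then show "(b + b', x + x') \<in> \<Gamma>'"
      using pd_poly_add[OF \<Gamma> pq(1,2)] unfolding \<Gamma>'_def by blast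
    have "(b * b', b * x' + x * b') = h (p * p', p * q' + q * p')"
      using pq(3,4) by (simp add: h_def pderiv_mult algebra_simps)
    then show "(b * b', b * x' + x * b') \<in> \<Gamma>'"
      using pd_poly_mult[OF \<Gamma> pq(1,2)] unfolding \<Gamma>'_def by blast
  next
    have "h ([:- 1:], [:0:]) = (- 1, 0)" by (simp add: h_def)
    then show "(- 1, 0) \<in> \<Gamma>'"
      using const[OF pd_minus_one[OF \<Gamma>]] unfolding \<Gamma>'_def by (metis imageI)
  next
    fix x assume "(0, x) \<in> \<Gamma>'"
    then show "x = 0" unfolding \<Gamma>'_def h_def using y by auto
  qed
  moreover have "\<Gamma> \<subseteq> \<Gamma>'"
  proof
    fix u assume "u \<in> \<Gamma>"
    moreover obtain b x where "u = (b, x)" by force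
    moreover have "h ([:b:], [:x:]) = (b, x)" by (simp add: h_def)
    ultimately show "u \<in> \<Gamma>'" using const unfolding \<Gamma>'_def by (metis imageI)
  qed
  moreover have "(a, y) \<in> \<Gamma>'"
  proof -
    have "h (monom 1 1, monom 0 1) = (a, y)" by (simp add: h_def poly_monom pderiv_monom)
    then show ?thesis using pd_poly_monom[OF \<Gamma> pd_one[OF \<Gamma>], of 1] unfolding \<Gamma>'_def by (metis imageI)
  qed
  ultimately show ?thesis by blast
qed

text \<open>By Zorn's lemma there is a maximal partial derivation above \<Gamma>; it is defined
  everywhere because \<open>partial_derivation_extend\<close> could otherwise enlarge it.\<close>

lemma partial_derivation_total:
  fixes \<Gamma> :: "('a::field_char_0 \<times> 'a) set"
  assumes \<Gamma>: "partial_derivation \<Gamma>"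
  obtains \<delta> where "derivation \<delta>" "\<And>a x. (a, x) \<in> \<Gamma> \<Longrightarrow> \<delta> a = x"
proof -
  define A where "A = {\<Gamma>'. partial_derivation \<Gamma>' \<and> \<Gamma> \<subseteq> \<Gamma>'}"
  have "\<exists>M\<in>A. \<forall>X\<in>A. M \<subseteq> X \<longrightarrow> X = M"
  proof (rule subset_Zorn_nonempty)
    show "A \<noteq> {}" using \<Gamma> unfolding A_def by blast
    fix C assume C: "C \<noteq> {}" "subset.chain A C"
    have pdC: "partial_derivation X" "\<Gamma> \<subseteq> X" if "X \<in> C" for X
      using C(2) that unfolding subset.chain_def A_def by blast+
    obtain X0 where "X0 \<in> C" using C(1) by blast
    have "partial_derivation (\<Union> C)"
      unfolding partial_derivation_def
    proof (intro conjI allI impI)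
      fix a x b y assume "(a, x) \<in> \<Union> C" "(b, y) \<in> \<Union> C"
      then obtain X Y where "X \<in> C" "Y \<in> C" "(a, x) \<in> X" "(b, y) \<in> Y" by blast
      moreover have "X \<subseteq> Y \<or> Y \<subseteq> X" using C(2) \<open>X \<in> C\<close> \<open>Y \<in> C\<close> unfolding subset.chain_def by blast
      ultimately obtain Z where Z: "Z \<in> C" "(a, x) \<in> Z" "(b, y) \<in> Z" by blast
      from pdC(1)[OF this(1)] have "partial_derivation Z" .
      from pd_add[OF this Z(2,3)] pd_mult[OF this Z(2,3)]
      show "(a + b, x + y) \<in> \<Union> C" "(a * b, a * y + x * b) \<in> \<Union> C"
        using Z(1) by (auto simp del: Union_iff intro: UnionI)
    next
      show "(- 1, 0) \<in> \<Union> C"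
        using pd_minus_one[OF pdC(1)[OF \<open>X0 \<in> C\<close>]] \<open>X0 \<in> C\<close> by (rule UnionI[rotated])
    next
      fix x assume "(0, x) \<in> \<Union> C"
      then obtain X where "X \<in> C" "(0, x) \<in> X" by (rule UnionE)
      then show "x = 0" using pd_zero_unique[OF pdC(1)] by simp
    qed
    moreover have "\<Gamma> \<subseteq> \<Union> C" using pdC(2)[OF \<open>X0 \<in> C\<close>] \<open>X0 \<in> C\<close> by (rule order.trans[OF _ Union_upper])
    ultimately show "\<Union> C \<in> A" unfolding A_def by simp
  qed
  then obtain M where M: "partial_derivation M" "\<Gamma> \<subseteq> M"
      and max: "\<And>X. partial_derivation X \<Longrightarrow> M \<subseteq> X \<Longrightarrow> X = M"
    unfolding A_def by (metis (no_types, lifting) mem_Collect_eq order.trans)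
  have "\<exists>y. (a, y) \<in> M" for a
    using partial_derivation_extend[OF M(1), of a] max by blast
  then obtain \<delta> where \<delta>: "\<And>a. (a, \<delta> a) \<in> M" by metis
  have eq: "\<delta> a = x" if "(a, x) \<in> M" for a x using pd_unique[OF M(1) \<delta> that] .
  have "derivation \<delta>"
    unfolding derivation_def using pd_add[OF M(1) \<delta> \<delta>] pd_mult[OF M(1) \<delta> \<delta>] eq by blast
  then show thesis using that eq M(2) by blast
qed

section \<open>Generic points\<close>

text \<open>Exponents are lists, since functions would make the type uncountable.\<close>

datatype pexpr = Num int | Var nat "nat list" | Plus pexpr pexpr | Times pexpr pexpr

instance pexpr :: countable by countable_datatype

definition list_exponent :: "nat list \<Rightarrow> nat \<Rightarrow> nat" where
  "list_exponent m i = (if i < length m then m ! i else 0)"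

fun peval :: "pexpr \<Rightarrow> (nat \<Rightarrow> (nat \<Rightarrow> nat) \<Rightarrow> complex) \<Rightarrow> complex" where
  "peval (Num c) s = of_int c"
| "peval (Var j m) s = s j (list_exponent m)"
| "peval (Plus e e') s = peval e s + peval e' s"
| "peval (Times e e') s = peval e s * peval e' s"

fun pdiff :: "pexpr \<Rightarrow> (nat \<Rightarrow> (nat \<Rightarrow> nat) \<Rightarrow> complex) \<Rightarrow> (nat \<Rightarrow> (nat \<Rightarrow> nat) \<Rightarrow> complex) \<Rightarrow> complex" where
  "pdiff (Num c) s v = 0"
| "pdiff (Var j m) s v = v j (list_exponent m)"
| "pdiff (Plus e e') s v = pdiff e s v + pdiff e' s v"
| "pdiff (Times e e') s v = peval e s * pdiff e' s v + pdiff e s v * peval e' s"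

lemma peval_polyfun: "peval e \<in> polyfun"
proof -
  have "(\<lambda>s. peval e s) \<in> polyfun"
    by (induction e) (auto intro: polyfun.intros)
  then show ?thesis by simp
qed

text \<open>This ties the formal \<open>pdiff\<close> to the function \<open>peval\<close>: an
  expression vanishing along the line through \<open>s\<close> in direction \<open>v\<close> has
  \<open>pdiff\<close> zero at \<open>s\<close>, whichever way it is written.\<close>

lemma peval_has_field_derivative:
  "((\<lambda>\<tau>. peval e (\<lambda>j \<alpha>. s j \<alpha> + \<tau> * v j \<alpha>)) has_field_derivative
     pdiff e (\<lambda>j \<alpha>. s j \<alpha> + \<tau> * v j \<alpha>) v) (at \<tau>)"
  by (induction e) (auto intro!: derivative_eq_intros)

text \<open>For \<open>S\<close> an affine space this says that the coordinates of \<open>s\<close> are algebraically independent over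
  the rationals.\<close>

definition generic_in :: "(nat \<Rightarrow> (nat \<Rightarrow> nat) \<Rightarrow> complex) set \<Rightarrow> (nat \<Rightarrow> (nat \<Rightarrow> nat) \<Rightarrow> complex) \<Rightarrow> bool" where
  "generic_in S s \<longleftrightarrow> s \<in> S \<and> (\<forall>e. peval e s = 0 \<longrightarrow> (\<forall>s'\<in>S. peval e s' = 0))"

text \<open>There are countably many integer expressions, hence countably many proper zero loci.
  Outside all of them, an expression vanishing at \<open>s\<close> has the whole of \<open>S\<close>
  as its zero locus.\<close>

lemma nongeneric_countable_closed:
  "\<exists>\<Z>. countable \<Z> \<and> (\<forall>Z\<in>\<Z>. zariski_closed_in S Z \<and> Z \<noteq> S) \<and> (\<forall>s\<in>S. s \<notin> \<Union>\<Z> \<longrightarrow> generic_in S s)"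
proof (intro exI conjI)
  define \<Z> where "\<Z> = {Z \<in> range (\<lambda>e. {s\<in>S. peval e s = 0}). Z \<noteq> S}"
  show "countable \<Z>"
    unfolding \<Z>_def by (rule countable_subset[of _ "range (\<lambda>e. {s\<in>S. peval e s = 0})"]) auto
  show "\<forall>Z\<in>\<Z>. zariski_closed_in S Z \<and> Z \<noteq> S"
  proof
    fix Z assume "Z \<in> \<Z>"
    then obtain e where "Z = {s\<in>S. \<forall>p\<in>{peval e}. p s = 0}" "Z \<noteq> S" unfolding \<Z>_def by auto
    then show "zariski_closed_in S Z \<and> Z \<noteq> S"
      unfolding zariski_closed_in_def using peval_polyfun[of e] by (intro conjI exI[of _ "{peval e}"]) auto
  qed
  show "\<forall>s\<in>S. s \<notin> \<Union>\<Z> \<longrightarrow> generic_in S s"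
    unfolding generic_in_def \<Z>_def by blast
qed

text \<open>Sending \<open>peval e s\<close> to the derivative of \<open>e\<close> along
  \<open>v\<close> is well defined: a relation at \<open>s\<close> holds on all of \<open>S\<close>
  by genericity, in particular on the line \<open>s + \<tau> v\<close>, so its derivative vanishes.
  This partial derivation then extends to all complex numbers.\<close>

lemma generic_derivation:
  assumes "generic_in (param_space n ds k) s" "v \<in> param_space n ds k"
  obtains \<delta> where "derivation \<delta>" "\<And>j m. \<delta> (s j (list_exponent m)) = v j (list_exponent m)"
proof -
  define \<Gamma> where "\<Gamma> = range (\<lambda>e. (peval e s, pdiff e s v))"
  have "partial_derivation \<Gamma>"
    unfolding partial_derivation_def
  proof (intro conjI allI impI)
    fix a x b y assume "(a, x) \<in> \<Gamma>" "(b, y) \<in> \<Gamma>"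
    then obtain e e' where e: "a = peval e s" "x = pdiff e s v" "b = peval e' s" "y = pdiff e' s v"
      unfolding \<Gamma>_def by auto
    show "(a + b, x + y) \<in> \<Gamma>"
      unfolding \<Gamma>_def e by (rule range_eqI[of _ _ "Plus e e'"]) simp
    show "(a * b, a * y + x * b) \<in> \<Gamma>"
      unfolding \<Gamma>_def e by (rule range_eqI[of _ _ "Times e e'"]) simp
  next
    show "(- 1, 0) \<in> \<Gamma>" unfolding \<Gamma>_def by (rule range_eqI[of _ _ "Num (- 1)"]) simp
  next
    fix x assume "(0, x) \<in> \<Gamma>"
    then obtain e where e: "peval e s = 0" "x = pdiff e s v" unfolding \<Gamma>_def by auto
    have "(\<lambda>j \<alpha>. s j \<alpha> + \<tau> * v j \<alpha>) \<in> param_space n ds k" for \<tau>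
      unfolding param_space_def
    proof (intro CollectI allI impI)
      fix j \<alpha> assume "s j \<alpha> + \<tau> * v j \<alpha> \<noteq> 0"
      then have "s j \<alpha> \<noteq> 0 \<or> v j \<alpha> \<noteq> 0" by auto
      then show "j \<le> length ds \<and> \<alpha> \<in> monoms n (degs ds k j)"
        using assms unfolding generic_in_def param_space_def by blast
    qed
    then have "peval e (\<lambda>j \<alpha>. s j \<alpha> + \<tau> * v j \<alpha>) = 0" for \<tau>
      using assms(1) e(1) unfolding generic_in_def by blast
    then have "((\<lambda>\<tau>::complex. 0::complex) has_field_derivative x) (at 0)"
      using peval_has_field_derivative[of e s v 0] e(2) by simp
    then show "x = 0" using DERIV_unique[OF _ DERIV_const] by blast
  qed
  then obtain \<delta> where \<delta>: "derivation \<delta>" "\<And>a x. (a, x) \<in> \<Gamma> \<Longrightarrow> \<delta> a = x"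
    using partial_derivation_total by metis
  have "\<delta> (s j (list_exponent m)) = v j (list_exponent m)" for j m
    unfolding \<Gamma>_def by (rule \<delta>(2)) (auto simp: \<Gamma>_def intro: range_eqI[of _ _ "Var j m"])
  then show thesis using that \<delta>(1) by blast
qed

section \<open>Forms evaluated at polynomials\<close>

lemma derivation_add: "derivation \<delta> \<Longrightarrow> \<delta> (a + b) = \<delta> a + \<delta> b"
  and derivation_mult: "derivation \<delta> \<Longrightarrow> \<delta> (a * b) = a * \<delta> b + \<delta> a * b"
  unfolding derivation_def by blast+

lemma derivation_0: "derivation \<delta> \<Longrightarrow> \<delta> 0 = 0"
  using derivation_add[of \<delta> 0 0] by simp

lemma derivation_1: "derivation \<delta> \<Longrightarrow> \<delta> 1 = 0"
  using derivation_mult[of \<delta> 1 1] by simp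

lemma derivation_sum: "derivation \<delta> \<Longrightarrow> \<delta> (\<Sum>i\<in>I. g i) = (\<Sum>i\<in>I. \<delta> (g i))"
  by (induction I rule: infinite_finite_induct) (auto simp: derivation_0 derivation_add)

lemma derivation_power:
  assumes "derivation \<delta>"
  shows "\<delta> (x ^ k) = of_nat k * x ^ (k - 1) * \<delta> x"
proof (induction k)
  case (Suc k)
  then show ?case
    by (cases k) (simp_all add: derivation_mult[OF assms] derivation_1[OF assms] algebra_simps)
qed (simp add: derivation_1[OF assms])

lemma derivation_prod:
  assumes "derivation \<delta>" "finite I"
  shows "\<delta> (\<Prod>i\<in>I. g i) = (\<Sum>i\<in>I. \<delta> (g i) * (\<Prod>j\<in>I - {i}. g j))"
  using assms(2)
proof (induction I rule: finite_induct)
  case (insert i I)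
  have "(\<Sum>k\<in>I. \<delta> (g k) * (\<Prod>j\<in>insert i I - {k}. g j)) =
      g i * (\<Sum>k\<in>I. \<delta> (g k) * (\<Prod>j\<in>I - {k}. g j))"
    unfolding sum_distrib_left
  proof (rule sum.cong)
    fix k assume "k \<in> I"
    then have "insert i I - {k} = insert i (I - {k})" using insert by auto
    then show "\<delta> (g k) * (\<Prod>j\<in>insert i I - {k}. g j) = g i * (\<delta> (g k) * (\<Prod>j\<in>I - {k}. g j))"
      using insert by (simp add: mult_ac)
  qed simp
  then show ?case using insert by (simp add: derivation_mult[OF assms(1)] add.commute)
qed (simp add: derivation_1[OF assms(1)])

text \<open>Acting on coefficients treats the parameter of the curve as a constant: this derivation
  moves the curve, whereas \<open>pderiv\<close> moves along it.\<close>

lemma derivation_map_poly: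
  assumes "derivation \<delta>"
  shows "derivation (map_poly \<delta>)"
proof -
  note [simp] = derivation_0[OF assms] derivation_add[OF assms]
  have "map_poly \<delta> (p * q) = p * map_poly \<delta> q + map_poly \<delta> p * q" for p q
    by (rule poly_eqI)
      (simp add: coeff_map_poly coeff_mult derivation_sum[OF assms] derivation_mult[OF assms] sum.distrib)
  then show ?thesis
    unfolding derivation_def by (auto intro: poly_eqI simp: coeff_map_poly)
qed

lemma derivation_pderiv: "derivation (pderiv :: 'a::idom poly \<Rightarrow> 'a poly)"
  unfolding derivation_def by (simp add: pderiv_add pderiv_mult mult.commute)

section \<open>Monomials and forms over a commutative ring\<close>

definition mono_eval :: "nat \<Rightarrow> (nat \<Rightarrow> 'a) \<Rightarrow> (nat \<Rightarrow> nat) \<Rightarrow> 'a::comm_ring_1" where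
  "mono_eval n x \<alpha> = (\<Prod>l\<le>n. x l ^ \<alpha> l)"

definition inc_exp :: "(nat \<Rightarrow> nat) \<Rightarrow> nat \<Rightarrow> nat \<Rightarrow> nat" where
  "inc_exp \<alpha> i = \<alpha>(i := Suc (\<alpha> i))"

definition dec_exp :: "(nat \<Rightarrow> nat) \<Rightarrow> nat \<Rightarrow> nat \<Rightarrow> nat" where
  "dec_exp \<alpha> i = \<alpha>(i := \<alpha> i - 1)"

text \<open>The formula of \<open>hom_eval\<close> over any commutative ring; at polynomial
  arguments it gives the pullback of a form to the line.\<close>

definition form_eval :: "nat \<Rightarrow> nat \<Rightarrow> ((nat \<Rightarrow> nat) \<Rightarrow> 'a) \<Rightarrow> (nat \<Rightarrow> 'a) \<Rightarrow> 'a::comm_ring_1" where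
  "form_eval n d F x = (\<Sum>\<alpha>\<in>monoms n d. F \<alpha> * mono_eval n x \<alpha>)"

text \<open>The truncated decrement in \<open>dec_exp\<close> does no harm, since the factor
  \<open>\<alpha> i\<close> vanishes whenever it truncates.\<close>

definition form_deriv :: "nat \<Rightarrow> nat \<Rightarrow> ((nat \<Rightarrow> nat) \<Rightarrow> 'a) \<Rightarrow> nat \<Rightarrow> (nat \<Rightarrow> 'a) \<Rightarrow> 'a::comm_ring_1" where
  "form_deriv n d F i x = (\<Sum>\<alpha>\<in>monoms n d. F \<alpha> * of_nat (\<alpha> i) * mono_eval n x (dec_exp \<alpha> i))"

lemma hom_eval_eq_form_eval: "hom_eval n d F x = form_eval n d F x"
  unfolding hom_eval_def form_eval_def mono_eval_def ..

lemma hom_deriv_eval_eq_form_deriv: "hom_deriv_eval n d F i x = form_deriv n d F i x"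
  unfolding hom_deriv_eval_def form_deriv_def mono_eval_def dec_exp_def
  by (intro sum.cong refl arg_cong2[where f = "(*)"] prod.cong) auto

lemma monoms_le:
  assumes "\<alpha> \<in> monoms n d" "i \<le> n"
  shows "\<alpha> i \<le> d"
  using assms(1) member_le_sum[of i "{..n}" \<alpha>] assms(2) by (simp add: monoms_def)

lemma finite_monoms: "finite (monoms n d)"
proof (rule finite_subset)
  show "monoms n d \<subseteq> {\<alpha>. \<forall>i. (i \<in> {..n} \<longrightarrow> \<alpha> i \<in> {..d}) \<and> (i \<notin> {..n} \<longrightarrow> \<alpha> i = 0)}"
  proof (intro subsetI CollectI allI conjI impI)
    fix \<alpha> i assume \<alpha>: "\<alpha> \<in> monoms n d"
    show "i \<in> {..n} \<Longrightarrow> \<alpha> i \<in> {..d}" using monoms_le[OF \<alpha>] by simp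
    show "i \<notin> {..n} \<Longrightarrow> \<alpha> i = 0" using \<alpha> by (simp add: monoms_def)
  qed
  show "finite {\<alpha>. \<forall>i. (i \<in> {..n} \<longrightarrow> \<alpha> i \<in> {..d}) \<and> (i \<notin> {..n} \<longrightarrow> \<alpha> i = (0::nat))}"
    by (rule finite_set_of_finite_funs) auto
qed

lemma sum_fun_upd:
  fixes \<alpha> :: "nat \<Rightarrow> nat"
  assumes "i \<le> n"
  shows "(\<Sum>l\<le>n. (\<alpha>(i := m)) l) + \<alpha> i = (\<Sum>l\<le>n. \<alpha> l) + m"
proof -
  have "(\<Sum>l\<in>{..n} - {i}. (\<alpha>(i := m)) l) = (\<Sum>l\<in>{..n} - {i}. \<alpha> l)" by (rule sum.cong) auto
  then show ?thesis
    using assms by (simp add: sum.remove[of "{..n}" i])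
qed

lemma inc_monoms: "\<alpha> \<in> monoms n d \<Longrightarrow> i \<le> n \<Longrightarrow> inc_exp \<alpha> i \<in> monoms n (Suc d)"
  using sum_fun_upd[of i n \<alpha> "Suc (\<alpha> i)"] unfolding monoms_def inc_exp_def by auto

lemma monoms_pos_index: "\<alpha> \<in> monoms n d \<Longrightarrow> \<alpha> i > 0 \<Longrightarrow> i \<le> n"
  unfolding monoms_def by (metis (mono_tags, lifting) mem_Collect_eq not_le less_irrefl)

lemma dec_monoms:
  assumes "\<alpha> \<in> monoms n d" "\<alpha> i > 0"
  shows "dec_exp \<alpha> i \<in> monoms n (d - 1)"
  using sum_fun_upd[of i n \<alpha> "\<alpha> i - 1"] assms monoms_pos_index[OF assms]
  unfolding monoms_def dec_exp_def by auto

lemma mono_eval_split: "i \<le> n \<Longrightarrow> mono_eval n x \<alpha> = x i ^ \<alpha> i * (\<Prod>l\<in>{..n} - {i}. x l ^ \<alpha> l)"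
  unfolding mono_eval_def by (rule prod.remove) auto

lemma mono_eval_upd:
  assumes "i \<le> n"
  shows "mono_eval n x (\<alpha>(i := m)) = x i ^ m * (\<Prod>l\<in>{..n} - {i}. x l ^ \<alpha> l)"
proof -
  have "(\<Prod>l\<in>{..n} - {i}. x l ^ (\<alpha>(i := m)) l) = (\<Prod>l\<in>{..n} - {i}. x l ^ \<alpha> l)"
    by (rule prod.cong) auto
  then show ?thesis using mono_eval_split[OF assms, of x "\<alpha>(i := m)"] by simp
qed

lemma mono_eval_inc: "i \<le> n \<Longrightarrow> mono_eval n x (inc_exp \<alpha> i) = mono_eval n x \<alpha> * x i"
  unfolding inc_exp_def by (simp add: mono_eval_upd mono_eval_split mult_ac)

lemma mono_eval_dec:
  assumes "i \<le> n"
  shows "of_nat (\<alpha> i) * (mono_eval n x (dec_exp \<alpha> i) * x i) = of_nat (\<alpha> i) * mono_eval n x \<alpha>"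
  unfolding dec_exp_def mono_eval_upd[OF assms] mono_eval_split[OF assms, of x \<alpha>]
  by (cases "\<alpha> i") (simp_all add: mult_ac)

text \<open>Each monomial is an eigenvector of the Euler field, with the sum of its exponents as
  eigenvalue.\<close>

lemma euler_identity: "(\<Sum>i\<le>n. form_deriv n d F i x * x i) = of_nat d * form_eval n d F x"
proof -
  have "(\<Sum>i\<le>n. form_deriv n d F i x * x i) =
      (\<Sum>i\<le>n. \<Sum>\<alpha>\<in>monoms n d. F \<alpha> * (of_nat (\<alpha> i) * mono_eval n x \<alpha>))"
    unfolding form_deriv_def sum_distrib_right
    by (intro sum.cong refl) (simp add: mult.assoc mono_eval_dec)
  also have "\<dots> = (\<Sum>\<alpha>\<in>monoms n d. F \<alpha> * (of_nat (\<Sum>i\<le>n. \<alpha> i) * mono_eval n x \<alpha>))"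
    by (subst sum.swap) (simp add: of_nat_sum sum_distrib_left sum_distrib_right)
  also have "\<dots> = of_nat d * form_eval n d F x"
    unfolding form_eval_def sum_distrib_left by (intro sum.cong) (auto simp: monoms_def mult_ac)
  finally show ?thesis .
qed

lemma derivation_mono_eval:
  assumes "derivation \<delta>"
  shows "\<delta> (mono_eval n x \<alpha>) = (\<Sum>i\<le>n. of_nat (\<alpha> i) * mono_eval n x (dec_exp \<alpha> i) * \<delta> (x i))"
  unfolding mono_eval_def[of n x \<alpha>] derivation_prod[OF assms finite_atMost] derivation_power[OF assms]
  by (intro sum.cong refl) (simp add: dec_exp_def mono_eval_upd mult_ac)

text \<open>The first sum comes from moving the coefficients of the form, the second from moving the
  point. The rule serves both for \<open>map_poly \<delta>\<close>, which yields deformations, and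
  for \<open>pderiv\<close>, which yields the tangent vector of the curve.\<close>

lemma derivation_form_eval:
  assumes "derivation \<delta>"
  shows "\<delta> (form_eval n d F x) =
      (\<Sum>\<alpha>\<in>monoms n d. \<delta> (F \<alpha>) * mono_eval n x \<alpha>) + (\<Sum>i\<le>n. form_deriv n d F i x * \<delta> (x i))"
proof -
  have "\<delta> (form_eval n d F x) = (\<Sum>\<alpha>\<in>monoms n d. F \<alpha> * \<delta> (mono_eval n x \<alpha>)) +
      (\<Sum>\<alpha>\<in>monoms n d. \<delta> (F \<alpha>) * mono_eval n x \<alpha>)"
    unfolding form_eval_def by (simp add: derivation_sum[OF assms] derivation_mult[OF assms] sum.distrib)
  also have "(\<Sum>\<alpha>\<in>monoms n d. F \<alpha> * \<delta> (mono_eval n x \<alpha>)) = (\<Sum>i\<le>n. form_deriv n d F i x * \<delta> (x i))"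
    unfolding derivation_mono_eval[OF assms] form_deriv_def sum_distrib_left sum_distrib_right
    by (subst sum.swap) (simp add: mult_ac)
  finally show ?thesis by (simp add: add.commute)
qed

section \<open>Forms along a polynomial curve\<close>

abbreviation const_coeffs :: "('b \<Rightarrow> complex) \<Rightarrow> 'b \<Rightarrow> complex poly" where
  "const_coeffs F \<equiv> \<lambda>\<alpha>. [:F \<alpha>:]"

lemma poly_mono_eval: "poly (mono_eval n f \<alpha>) t = mono_eval n (\<lambda>i. poly (f i) t) \<alpha>"
  unfolding mono_eval_def by (simp add: poly_prod)

lemma poly_form_eval: "poly (form_eval n d (const_coeffs F) f) t = form_eval n d F (\<lambda>i. poly (f i) t)"
  unfolding form_eval_def by (simp add: poly_sum poly_mono_eval)

lemma poly_of_nat_eval: "poly (of_nat k) t = of_nat k"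
  by (simp add: of_nat_poly)

lemma poly_form_deriv: "poly (form_deriv n d (const_coeffs F) i f) t = form_deriv n d F i (\<lambda>i. poly (f i) t)"
  unfolding form_deriv_def by (simp add: poly_sum poly_mono_eval poly_of_nat_eval mult.assoc)

lemma degree_power_bound: "degree q \<le> e \<Longrightarrow> degree (q ^ k) \<le> k * e"
  using degree_power_le[of q k] by (metis mult.commute mult_le_mono1 order.trans)

lemma coeff_power_bound:
  assumes "degree q \<le> e"
  shows "coeff (q ^ k) (k * e) = coeff q e ^ k"
proof (induction k)
  case (Suc k)
  then show ?case
    using coeff_mult_at_degree_bounds[OF assms degree_power_bound[OF assms, of k]] by simp
qed simp

lemma mono_eval_bounds:
  assumes "\<And>i. i \<le> n \<Longrightarrow> degree (f i) \<le> e"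
  shows "degree (mono_eval n f \<alpha>) \<le> (\<Sum>i\<le>n. \<alpha> i) * e"
    and "coeff (mono_eval n f \<alpha>) ((\<Sum>i\<le>n. \<alpha> i) * e) = mono_eval n (\<lambda>i. coeff (f i) e) \<alpha>"
proof -
  have *: "degree (f i ^ \<alpha> i) \<le> \<alpha> i * e" "coeff (f i ^ \<alpha> i) (\<alpha> i * e) = coeff (f i) e ^ \<alpha> i" if "i \<le> n" for i
    using degree_power_bound coeff_power_bound assms[OF that] by auto
  show "degree (mono_eval n f \<alpha>) \<le> (\<Sum>i\<le>n. \<alpha> i) * e"
    unfolding mono_eval_def sum_distrib_right by (rule degree_prod_sum_bound) (auto simp: *)
  show "coeff (mono_eval n f \<alpha>) ((\<Sum>i\<le>n. \<alpha> i) * e) = mono_eval n (\<lambda>i. coeff (f i) e) \<alpha>"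
    unfolding mono_eval_def sum_distrib_right
    by (subst coeff_prod_at_degree_bounds) (auto simp: * intro: prod.cong)
qed

text \<open>The numbers \<open>coeff (f i) e\<close> are the coordinates of the curve at infinity,
  and the coefficient at \<open>d * e\<close> is the value of the form there.\<close>

lemma coeff_form_eval:
  assumes "\<And>i. i \<le> n \<Longrightarrow> degree (f i) \<le> e"
  shows "coeff (form_eval n d (const_coeffs F) f) (d * e) = form_eval n d F (\<lambda>i. coeff (f i) e)"
  unfolding form_eval_def coeff_sum
proof (rule sum.cong)
  fix \<alpha> assume "\<alpha> \<in> monoms n d"
  then show "coeff ([:F \<alpha>:] * mono_eval n f \<alpha>) (d * e) = F \<alpha> * mono_eval n (\<lambda>i. coeff (f i) e) \<alpha>"
    using mono_eval_bounds(2)[of n f e \<alpha>] assms by (simp add: monoms_def)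
qed simp

lemma form_deriv_bounds:
  assumes "\<And>i. i \<le> n \<Longrightarrow> degree (f i) \<le> e"
  shows "degree (form_deriv n d (const_coeffs F) i f) \<le> (d - 1) * e"
    and "coeff (form_deriv n d (const_coeffs F) i f) ((d - 1) * e) = form_deriv n d F i (\<lambda>i. coeff (f i) e)"
proof -
  have *: "degree ([:F \<alpha>:] * of_nat (\<alpha> i) * mono_eval n f (dec_exp \<alpha> i)) \<le> (d - 1) * e \<and>
      coeff ([:F \<alpha>:] * of_nat (\<alpha> i) * mono_eval n f (dec_exp \<alpha> i)) ((d - 1) * e) =
        F \<alpha> * of_nat (\<alpha> i) * mono_eval n (\<lambda>i. coeff (f i) e) (dec_exp \<alpha> i)"
    if "\<alpha> \<in> monoms n d" for \<alpha>
  proof (cases "\<alpha> i = 0")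
    case False
    then have "dec_exp \<alpha> i \<in> monoms n (d - 1)" using dec_monoms[OF that] by simp
    then have "(\<Sum>l\<le>n. dec_exp \<alpha> i l) = d - 1" by (simp add: monoms_def)
    then show ?thesis
      using mono_eval_bounds[of n f e "dec_exp \<alpha> i"] assms
      by (simp add: of_nat_poly degree_smult_le[THEN order.trans])
  qed simp
  then show "degree (form_deriv n d (const_coeffs F) i f) \<le> (d - 1) * e"
    unfolding form_deriv_def by (intro degree_sum_le finite_monoms) auto
  show "coeff (form_deriv n d (const_coeffs F) i f) ((d - 1) * e) = form_deriv n d F i (\<lambda>i. coeff (f i) e)"
    unfolding form_deriv_def coeff_sum using * by (intro sum.cong) auto
qed

section \<open>Lifting kernel vectors of the Jacobian\<close>

text \<open>Asks for a polynomial kernel field through \<open>y\<close>. The bound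
  \<open>2 * e\<close> is that of a component of the curve times a first order deformation, both of
  degree at most \<open>e\<close>.\<close>

definition kernel_lift :: "nat \<Rightarrow> nat \<Rightarrow> nat \<Rightarrow> (nat \<Rightarrow> nat \<Rightarrow> complex poly) \<Rightarrow> complex \<Rightarrow> (nat \<Rightarrow> complex) \<Rightarrow> bool" where
  "kernel_lift n e p J t y \<longleftrightarrow> (\<exists>u. (\<forall>i\<le>n. degree (u i) \<le> 2 * e) \<and>
     (\<forall>l<p. (\<Sum>i\<le>n. J l i * u i) = 0) \<and> (\<forall>i\<le>n. poly (u i) t = y i))"

text \<open>\<open>G j \<alpha>\<close> is a first order motion of the curve that compensates for
  varying coefficient \<alpha> of equation \<open>j\<close>. The index \<open>b\<close> marks a
  coordinate of the curve that is invertible at \<open>t0\<close>.\<close>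

context
  fixes n e p :: nat and deg :: "nat \<Rightarrow> nat" and s :: "nat \<Rightarrow> (nat \<Rightarrow> nat) \<Rightarrow> complex"
    and f :: "nat \<Rightarrow> complex poly" and J :: "nat \<Rightarrow> nat \<Rightarrow> complex poly"
    and G :: "nat \<Rightarrow> (nat \<Rightarrow> nat) \<Rightarrow> nat \<Rightarrow> complex poly" and b :: nat and t0 :: complex
  assumes J: "\<And>l i. J l i = form_deriv n (deg l) (const_coeffs (s l)) i f"
    and deg_pos: "\<And>j. j < p \<Longrightarrow> deg j \<ge> 1"
    and degf: "\<And>i. i \<le> n \<Longrightarrow> degree (f i) \<le> e"
    and degG: "\<And>j \<alpha> i. j < p \<Longrightarrow> \<alpha> \<in> monoms n (deg j) \<Longrightarrow> i \<le> n \<Longrightarrow> degree (G j \<alpha> i) \<le> e"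
    and JG: "\<And>l j \<alpha>. l < p \<Longrightarrow> j < p \<Longrightarrow> \<alpha> \<in> monoms n (deg j) \<Longrightarrow>
      (\<Sum>i\<le>n. J l i * G j \<alpha> i) = (if l = j then - mono_eval n f \<alpha> else 0)"
    and b: "b \<le> n" "poly (f b) t0 \<noteq> 0"
begin

abbreviation lifts where "lifts \<equiv> kernel_lift n e p J t0"

lemma lifts_cong:
  assumes "lifts y" "\<And>i. i \<le> n \<Longrightarrow> y i = y' i"
  shows "lifts y'"
  using assms(1) unfolding kernel_lift_def by (simp add: assms(2))

lemma lifts_add:
  assumes "lifts y" "lifts y'"
  shows "lifts (\<lambda>i. y i + y' i)"
proof -
  obtain u where u: "\<forall>i\<le>n. degree (u i) \<le> 2 * e" "\<forall>l<p. (\<Sum>i\<le>n. J l i * u i) = 0"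
    "\<forall>i\<le>n. poly (u i) t0 = y i"
    using assms(1) unfolding kernel_lift_def by blast
  obtain u' where u': "\<forall>i\<le>n. degree (u' i) \<le> 2 * e" "\<forall>l<p. (\<Sum>i\<le>n. J l i * u' i) = 0"
    "\<forall>i\<le>n. poly (u' i) t0 = y' i"
    using assms(2) unfolding kernel_lift_def by blast
  show ?thesis
    unfolding kernel_lift_def using u u'
    by (intro exI[of _ "\<lambda>i. u i + u' i"]) (auto simp: ring_distribs sum.distrib intro: degree_add_le)
qed

lemma lifts_scale:
  assumes "lifts y"
  shows "lifts (\<lambda>i. c * y i)"
proof -
  obtain u where u: "\<forall>i\<le>n. degree (u i) \<le> 2 * e" "\<forall>l<p. (\<Sum>i\<le>n. J l i * u i) = 0"
    "\<forall>i\<le>n. poly (u i) t0 = y i"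
    using assms unfolding kernel_lift_def by blast
  have "(\<Sum>i\<le>n. J l i * Polynomial.smult c (u i)) = [:c:] * (\<Sum>i\<le>n. J l i * u i)" for l
    unfolding sum_distrib_left by (rule sum.cong) simp_all
  then show ?thesis
    unfolding kernel_lift_def using u
    by (intro exI[of _ "\<lambda>i. Polynomial.smult c (u i)"]) (auto intro: degree_smult_le[THEN order.trans])
qed

lemma lifts_zero: "lifts (\<lambda>i. 0)"
  unfolding kernel_lift_def by (intro exI[of _ "\<lambda>i. 0"]) auto

lemma lifts_sum:
  "(\<And>k. k \<in> K \<Longrightarrow> lifts (y k)) \<Longrightarrow> lifts (\<lambda>i. \<Sum>k\<in>K. y k i)"
  by (induction K rule: infinite_finite_induct) (auto simp: lifts_zero lifts_add)

abbreviation Gval where "Gval j \<alpha> i \<equiv> poly (G j \<alpha> i) t0"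
abbreviation fval where "fval i \<equiv> poly (f i) t0"

text \<open>Global generation of \<open>M_d(1)\<close>, where \<open>M_d\<close> is the kernel of the evaluation of degree \<open>d\<close> forms.\<close>

lemma lifts_exchange:
  assumes "j < p" "\<gamma> \<in> monoms n (deg j - 1)" "a \<le> n"
  shows "lifts (\<lambda>i. fval b * Gval j (inc_exp \<gamma> a) i - fval a * Gval j (inc_exp \<gamma> b) i)"
proof -
  have m: "inc_exp \<gamma> a \<in> monoms n (deg j)" "inc_exp \<gamma> b \<in> monoms n (deg j)"
    using inc_monoms[OF assms(2) assms(3)] inc_monoms[OF assms(2) b(1)] deg_pos[OF assms(1)] by simp_all
  define u where "u = (\<lambda>i. f b * G j (inc_exp \<gamma> a) i - f a * G j (inc_exp \<gamma> b) i)"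
  have "degree (u i) \<le> 2 * e" if "i \<le> n" for i
    unfolding u_def mult_2
    using degf[OF b(1)] degf[OF assms(3)] degG[OF assms(1) m(1) that] degG[OF assms(1) m(2) that]
    by (intro degree_diff_le order.trans[OF degree_mult_le] add_mono)
  moreover have "(\<Sum>i\<le>n. J l i * u i) = 0" if "l < p" for l
  proof -
    have "(\<Sum>i\<le>n. J l i * u i) =
        f b * (\<Sum>i\<le>n. J l i * G j (inc_exp \<gamma> a) i) - f a * (\<Sum>i\<le>n. J l i * G j (inc_exp \<gamma> b) i)"
      unfolding u_def by (simp add: sum_distrib_left right_diff_distrib sum_subtractf mult_ac)
    then show ?thesis
      unfolding JG[OF that assms(1) m(1)] JG[OF that assms(1) m(2)]
      using assms(3) b(1) by (simp add: mono_eval_inc)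
  qed
  ultimately show ?thesis
    unfolding kernel_lift_def by (intro exI[of _ u]) (auto simp: u_def)
qed

text \<open>Modulo vectors that lift, \<open>Gval j\<close> behaves like evaluation of monomials at
  the point. Each exchange moves one unit of the exponent from another variable to \<open>b\<close>,
  until a pure power of that variable remains.\<close>

lemma lifts_reduce:
  assumes "j < p" "\<beta> \<in> monoms n (deg j - 1)"
  shows "lifts (\<lambda>i. fval b ^ (deg j - 1) * Gval j (inc_exp \<beta> b) i -
    mono_eval n fval \<beta> * Gval j (inc_exp (\<lambda>l. if l = b then deg j - 1 else 0) b) i)"
  using assms(2)
proof (induction "deg j - 1 - \<beta> b" arbitrary: \<beta> rule: less_induct)
  case less
  define M where "M = deg j - 1"
  define top where "top = inc_exp (\<lambda>l. if l = b then M else 0) b"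
  have sum: "(\<Sum>l\<le>n. \<beta> l) = M" "\<And>l. l > n \<Longrightarrow> \<beta> l = 0"
    using less.prems unfolding monoms_def M_def by auto
  have sum_b: "\<beta> b + (\<Sum>l\<in>{..n} - {b}. \<beta> l) = M"
    using sum(1) b(1) by (simp add: sum.remove[of "{..n}" b])
  show ?case
  proof (cases "\<exists>a\<le>n. a \<noteq> b \<and> \<beta> a > 0")
    case False
    then have 0: "\<beta> l = 0" if "l \<noteq> b" for l using that sum(2)[of l] by (cases "l \<le> n") auto
    then have "\<beta> b = M" using sum_b by simp
    then have \<beta>: "\<beta> = (\<lambda>l. if l = b then M else 0)" using 0 by auto
    have "mono_eval n fval \<beta> = fval b ^ M"
      unfolding mono_eval_split[OF b(1)] using 0 \<open>\<beta> b = M\<close> by simp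
    then show ?thesis unfolding M_def[symmetric] using lifts_zero by (subst \<beta>) simp
  next
    case True
    then obtain a where a: "a \<le> n" "a \<noteq> b" "\<beta> a > 0" by blast
    \<comment> \<open>Chosen so that raising it at \<open>a\<close> gives \<beta> raised at
      \<open>b\<close>, while its exponent at \<open>b\<close> is larger by one.\<close>
    define \<gamma> where "\<gamma> = inc_exp (dec_exp \<beta> a) b"
    have "M \<ge> 1" using a sum(1) member_le_sum[of a "{..n}" \<beta>] by auto
    have \<gamma>: "\<gamma> \<in> monoms n M"
      using inc_monoms[OF dec_monoms[OF less.prems a(3)] b(1)] \<open>M \<ge> 1\<close>
      unfolding \<gamma>_def M_def[symmetric] by simp
    have \<gamma>a: "inc_exp \<gamma> a = inc_exp \<beta> b" using a(2,3) by (auto simp: \<gamma>_def inc_exp_def dec_exp_def)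
    have "\<gamma> b = Suc (\<beta> b)" using a(2) by (auto simp: \<gamma>_def inc_exp_def dec_exp_def)
    moreover have "\<gamma> b \<le> M" using monoms_le[OF \<gamma> b(1)] .
    ultimately have IH: "lifts (\<lambda>i. fval b ^ M * Gval j (inc_exp \<gamma> b) i - mono_eval n fval \<gamma> * Gval j top i)"
      using less.hyps[of \<gamma>] \<gamma> unfolding M_def top_def by auto
    have ex: "lifts (\<lambda>i. fval b * Gval j (inc_exp \<beta> b) i - fval a * Gval j (inc_exp \<gamma> b) i)"
      using lifts_exchange[OF assms(1) _ a(1), of \<gamma>] \<gamma> unfolding \<gamma>a M_def by blast
    have mono: "mono_eval n fval \<gamma> * fval a = mono_eval n fval \<beta> * fval b"
      using mono_eval_inc[OF a(1), of fval \<gamma>] mono_eval_inc[OF b(1), of fval \<beta>] \<gamma>a by simp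
    \<comment> \<open>The middle terms of the exchange scaled by \<open>fval b ^ M\<close> and of
      the induction hypothesis scaled by \<open>fval a\<close> cancel; one factor
      \<open>fval b\<close> is then divided out.\<close>
    have "lifts (\<lambda>i. inverse (fval b) * (fval b ^ M * (fval b * Gval j (inc_exp \<beta> b) i - fval a * Gval j (inc_exp \<gamma> b) i) +
        fval a * (fval b ^ M * Gval j (inc_exp \<gamma> b) i - mono_eval n fval \<gamma> * Gval j top i)))"
      by (intro lifts_scale lifts_add ex IH)
    then show ?thesis
      unfolding M_def[symmetric] top_def[symmetric]
    proof (rule lifts_cong)
      fix i
      have "fval b ^ M * (fval b * Gval j (inc_exp \<beta> b) i - fval a * Gval j (inc_exp \<gamma> b) i) +
          fval a * (fval b ^ M * Gval j (inc_exp \<gamma> b) i - mono_eval n fval \<gamma> * Gval j top i) =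
          fval b * (fval b ^ M * Gval j (inc_exp \<beta> b) i) - (mono_eval n fval \<gamma> * fval a) * Gval j top i"
        by (simp add: algebra_simps)
      also have "\<dots> = fval b * (fval b ^ M * Gval j (inc_exp \<beta> b) i - mono_eval n fval \<beta> * Gval j top i)"
        unfolding mono by (simp add: algebra_simps)
      finally show "inverse (fval b) * (fval b ^ M * (fval b * Gval j (inc_exp \<beta> b) i - fval a * Gval j (inc_exp \<gamma> b) i) +
          fval a * (fval b ^ M * Gval j (inc_exp \<gamma> b) i - mono_eval n fval \<gamma> * Gval j top i)) =
          fval b ^ M * Gval j (inc_exp \<beta> b) i - mono_eval n fval \<beta> * Gval j top i"
        using b(2) by simp
    qed
  qed
qed

text \<open>The field \<open>f b\<close> times \<open>x\<close> need not lie in the kernel of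
  \<open>J\<close>, but its image is a combination of monomials in \<open>f\<close>, which the
  deformations \<open>G\<close> cancel. The corrected field \<open>w\<close> lifts its value at
  \<open>t0\<close>, and the corrections \<open>y j\<close> lift by \<open>lifts_reduce\<close>;
  subtracting them and dividing by \<open>fval b\<close> leaves \<open>x\<close>.\<close>

lemma lifts_kernel:
  assumes x: "\<And>l. l < p \<Longrightarrow> (\<Sum>i\<le>n. poly (J l i) t0 * x i) = 0"
  shows "lifts x"
proof -
  define c where "c = (\<lambda>j \<alpha> i'. s j \<alpha> * of_nat (\<alpha> i') * x i')"
  define w where "w = (\<lambda>i. [:x i:] * f b +
      (\<Sum>j<p. \<Sum>\<alpha>\<in>monoms n (deg j). \<Sum>i'\<le>n. [:c j \<alpha> i':] * G j (inc_exp (dec_exp \<alpha> i') b) i))"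
  define y where "y = (\<lambda>j i. \<Sum>\<alpha>\<in>monoms n (deg j). \<Sum>i'\<le>n. c j \<alpha> i' * Gval j (inc_exp (dec_exp \<alpha> i') b) i)"
  have dec_exp: "dec_exp \<alpha> i' \<in> monoms n (deg j - 1)" "inc_exp (dec_exp \<alpha> i') b \<in> monoms n (deg j)"
    if "j < p" "\<alpha> \<in> monoms n (deg j)" "\<alpha> i' \<noteq> 0" for j \<alpha> i'
  proof -
    show *: "dec_exp \<alpha> i' \<in> monoms n (deg j - 1)" using dec_monoms[OF that(2)] that(3) by simp
    show "inc_exp (dec_exp \<alpha> i') b \<in> monoms n (deg j)" using inc_monoms[OF * b(1)] deg_pos[OF that(1)] by simp
  qed
  have c0: "c j \<alpha> i' = 0" if "\<alpha> i' = 0" for j \<alpha> i' using that by (simp add: c_def)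
  have "degree (w i) \<le> 2 * e" if "i \<le> n" for i
  proof -
    have "degree ([:c j \<alpha> i':] * G j (inc_exp (dec_exp \<alpha> i') b) i) \<le> e"
      if "j < p" "\<alpha> \<in> monoms n (deg j)" for j \<alpha> i'
    proof (cases "\<alpha> i' = 0")
      case False
      then show ?thesis using degG[OF that(1) dec_exp(2)[OF that False] \<open>i \<le> n\<close>]
        by (simp add: degree_smult_le[THEN order.trans])
    qed (simp add: c0)
    then have "degree (w i) \<le> e"
      unfolding w_def using degf[OF b(1)]
      by (intro degree_add_le degree_sum_le finite_monoms)
        (auto intro: degree_smult_le[THEN order.trans])
    then show ?thesis by simp
  qed
  moreover have "(\<Sum>i\<le>n. J l i * w i) = 0" if l: "l < p" for l
  proof -
    have "(\<Sum>i\<le>n. J l i * w i) = (\<Sum>i\<le>n. J l i * ([:x i:] * f b)) +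
        (\<Sum>i\<le>n. \<Sum>j<p. \<Sum>\<alpha>\<in>monoms n (deg j). \<Sum>i'\<le>n.
          J l i * ([:c j \<alpha> i':] * G j (inc_exp (dec_exp \<alpha> i') b) i))"
      unfolding w_def by (simp only: distrib_left sum.distrib sum_distrib_left)
    also have "(\<Sum>i\<le>n. \<Sum>j<p. \<Sum>\<alpha>\<in>monoms n (deg j). \<Sum>i'\<le>n.
          J l i * ([:c j \<alpha> i':] * G j (inc_exp (dec_exp \<alpha> i') b) i)) =
        (\<Sum>j<p. \<Sum>\<alpha>\<in>monoms n (deg j). \<Sum>i'\<le>n. \<Sum>i\<le>n.
          J l i * ([:c j \<alpha> i':] * G j (inc_exp (dec_exp \<alpha> i') b) i))"
      by (subst sum.swap, rule sum.cong[OF refl], subst sum.swap, rule sum.cong[OF refl],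
          subst sum.swap, rule refl)
    also have "\<dots> = (\<Sum>j<p. \<Sum>\<alpha>\<in>monoms n (deg j). \<Sum>i'\<le>n.
          if l = j then - ([:c j \<alpha> i':] * (mono_eval n f (dec_exp \<alpha> i') * f b)) else 0)"
    proof (intro sum.cong refl)
      fix j \<alpha> i' assume j: "j \<in> {..<p}" "\<alpha> \<in> monoms n (deg j)"
      have "(\<Sum>i\<le>n. J l i * ([:c j \<alpha> i':] * G j (inc_exp (dec_exp \<alpha> i') b) i)) =
          [:c j \<alpha> i':] * (\<Sum>i\<le>n. J l i * G j (inc_exp (dec_exp \<alpha> i') b) i)"
        unfolding sum_distrib_left by (simp only: mult_ac)
      also have "\<dots> = (if l = j then - ([:c j \<alpha> i':] * (mono_eval n f (dec_exp \<alpha> i') * f b)) else 0)"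
      proof (cases "\<alpha> i' = 0")
        case False
        then show ?thesis using JG[OF l _ dec_exp(2)[OF _ j(2) False]] j(1) b(1) by (simp add: mono_eval_inc)
      qed (simp add: c0)
      finally show "(\<Sum>i\<le>n. J l i * ([:c j \<alpha> i':] * G j (inc_exp (dec_exp \<alpha> i') b) i)) = \<dots>" .
    qed
    also have "\<dots> = (\<Sum>j<p. if l = j then \<Sum>\<alpha>\<in>monoms n (deg j). \<Sum>i'\<le>n.
         - ([:c j \<alpha> i':] * (mono_eval n f (dec_exp \<alpha> i') * f b)) else 0)"
      by (intro sum.cong refl) auto
    also have "\<dots> = (\<Sum>\<alpha>\<in>monoms n (deg l). \<Sum>i'\<le>n.
         - ([:c l \<alpha> i':] * (mono_eval n f (dec_exp \<alpha> i') * f b)))"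
      using l by (simp add: sum.delta)
    also have "\<dots> = (\<Sum>i'\<le>n. \<Sum>\<alpha>\<in>monoms n (deg l).
         - ([:c l \<alpha> i':] * (mono_eval n f (dec_exp \<alpha> i') * f b)))" by (rule sum.swap)
    also have "\<dots> = - (\<Sum>i\<le>n. J l i * ([:x i:] * f b))"
      unfolding J form_deriv_def sum_negf[symmetric] sum_distrib_right
      by (intro sum.cong refl) (simp add: c_def of_nat_poly mult_ac)
    finally show ?thesis by simp
  qed
  moreover have "poly (w i) t0 = x i * fval b + (\<Sum>j<p. y j i)" for i
    unfolding w_def y_def by (simp add: poly_sum)
  ultimately have w: "lifts (\<lambda>i. x i * fval b + (\<Sum>j<p. y j i))"
    unfolding kernel_lift_def by blast
  have y: "lifts (y j)" if j: "j < p" for j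
  proof -
    define M where "M = deg j - 1"
    define top where "top = inc_exp (\<lambda>l. if l = b then M else 0) b"
    have "lifts (\<lambda>i. c j \<alpha> i' * (fval b ^ M * Gval j (inc_exp (dec_exp \<alpha> i') b) i -
        mono_eval n fval (dec_exp \<alpha> i') * Gval j top i))" if "\<alpha> \<in> monoms n (deg j)" for \<alpha> i'
    proof (cases "\<alpha> i' = 0")
      case False
      show ?thesis
        using lifts_scale[OF lifts_reduce[OF j dec_exp(1)[OF j that False]]] unfolding M_def top_def .
    qed (simp add: c0 lifts_zero)
    then have "lifts (\<lambda>i. inverse (fval b ^ M) * (\<Sum>\<alpha>\<in>monoms n (deg j). \<Sum>i'\<le>n.
        c j \<alpha> i' * (fval b ^ M * Gval j (inc_exp (dec_exp \<alpha> i') b) i - mono_eval n fval (dec_exp \<alpha> i') * Gval j top i)))"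
      by (rule lifts_scale[OF lifts_sum[OF lifts_sum]])
    then show ?thesis
    proof (rule lifts_cong)
      fix i
      \<comment> \<open>The remainders left by \<open>lifts_reduce\<close> add up to
        \<open>Gval j top\<close> times row \<open>j\<close> of the Jacobian at \<open>t0\<close>
        applied to \<open>x\<close>, which is 0.\<close>
      have "(\<Sum>\<alpha>\<in>monoms n (deg j). \<Sum>i'\<le>n. c j \<alpha> i' * (mono_eval n fval (dec_exp \<alpha> i') * Gval j top i)) =
          (\<Sum>i'\<le>n. poly (J j i') t0 * x i') * Gval j top i"
        unfolding J poly_form_deriv unfolding form_deriv_def sum_distrib_right c_def
        by (subst sum.swap) (simp add: mult_ac)
      also have "\<dots> = 0" using x[OF j] by simp
      finally have 0: "(\<Sum>\<alpha>\<in>monoms n (deg j). \<Sum>i'\<le>n.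
          c j \<alpha> i' * (mono_eval n fval (dec_exp \<alpha> i') * Gval j top i)) = 0" .
      have "(\<Sum>\<alpha>\<in>monoms n (deg j). \<Sum>i'\<le>n.
          c j \<alpha> i' * (fval b ^ M * Gval j (inc_exp (dec_exp \<alpha> i') b) i - mono_eval n fval (dec_exp \<alpha> i') * Gval j top i)) =
          fval b ^ M * y j i"
        unfolding right_diff_distrib sum_subtractf 0 y_def sum_distrib_left
        by (simp add: mult_ac)
      then show "inverse (fval b ^ M) * (\<Sum>\<alpha>\<in>monoms n (deg j). \<Sum>i'\<le>n.
          c j \<alpha> i' * (fval b ^ M * Gval j (inc_exp (dec_exp \<alpha> i') b) i - mono_eval n fval (dec_exp \<alpha> i') * Gval j top i)) = y j i"
        using b(2) by simp
    qed
  qed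
  have "lifts (\<lambda>i. inverse (fval b) * ((x i * fval b + (\<Sum>j<p. y j i)) + (- 1) * (\<Sum>j<p. y j i)))"
    by (intro lifts_scale lifts_add w lifts_sum y) auto
  then show ?thesis by (rule lifts_cong) (use b(2) in simp)
qed

end

section \<open>Curves in the complement of the boundary\<close>

lemma degree_map_poly_derivation: "derivation \<delta> \<Longrightarrow> degree (map_poly \<delta> q) \<le> degree q"
  by (rule degree_le) (simp add: coeff_map_poly coeff_eq_0 derivation_0)

text \<open>Every monomial is coded by a list, so the countably many \<open>Var\<close> reach all
  coordinates of \<open>S\<close>.\<close>

lemma monoms_list_exponent:
  assumes "\<alpha> \<in> monoms n d"
  shows "\<alpha> = list_exponent (map \<alpha> [0..<Suc n])"
proof
  fix i
  show "\<alpha> i = list_exponent (map \<alpha> [0..<Suc n]) i"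
    using assms by (cases "i < Suc n") (auto simp: list_exponent_def monoms_def simp del: upt_Suc)
qed

text \<open>Take \<delta> extending the unit tangent vector at coefficient \<alpha> of equation
  \<open>j\<close>. Although \<open>f\<close> is not given as a function of \<open>s\<close>,
  \<delta> also moves its coefficients, and applying it to the equations along \<open>f\<close>
  gives the linearized equations.\<close>

lemma first_order_deformation:
  assumes "generic_in (param_space n ds k) s" "j \<le> length ds" "\<alpha> \<in> monoms n (degs ds k j)"
  shows "\<exists>\<delta>. derivation \<delta> \<and> (\<forall>l. map_poly \<delta> (form_eval n (degs ds k l) (const_coeffs (s l)) f) =
      (if l = j then mono_eval n f \<alpha> else 0) +
      (\<Sum>i\<le>n. form_deriv n (degs ds k l) (const_coeffs (s l)) i f * map_poly \<delta> (f i)))"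
proof -
  define v where "v = (\<lambda>j' \<alpha>'. if j' = j \<and> \<alpha>' = \<alpha> then 1 else (0::complex))"
  have "v \<in> param_space n ds k"
    using assms(2,3) unfolding v_def param_space_def by (simp split: if_splits)
  then obtain \<delta> where \<delta>: "derivation \<delta>" "\<And>j m. \<delta> (s j (list_exponent m)) = v j (list_exponent m)"
    using generic_derivation[OF assms(1)] by metis
  have v: "\<delta> (s l \<beta>) = v l \<beta>" if "\<beta> \<in> monoms n d" for l \<beta> d
    using \<delta>(2)[of l "map \<beta> [0..<Suc n]"] monoms_list_exponent[OF that] by simp
  have "map_poly \<delta> (form_eval n (degs ds k l) (const_coeffs (s l)) f) =
      (if l = j then mono_eval n f \<alpha> else 0) +
      (\<Sum>i\<le>n. form_deriv n (degs ds k l) (const_coeffs (s l)) i f * map_poly \<delta> (f i))" for l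
  proof -
    have "(\<Sum>\<beta>\<in>monoms n (degs ds k l). map_poly \<delta> [:s l \<beta>:] * mono_eval n f \<beta>) =
        (\<Sum>\<beta>\<in>monoms n (degs ds k l). if \<beta> = \<alpha> then (if l = j then mono_eval n f \<alpha> else 0) else 0)"
      by (intro sum.cong) (auto simp: map_poly_pCons v derivation_0[OF \<delta>(1)] v_def)
    also have "\<dots> = (if l = j then mono_eval n f \<alpha> else 0)"
      using assms(3) by (auto simp: sum.delta finite_monoms)
    finally show ?thesis
      unfolding derivation_form_eval[OF derivation_map_poly[OF \<delta>(1)]] by simp
  qed
  then show ?thesis using \<delta>(1) by (intro exI[of _ \<delta>]) simp
qed

text \<open>At a root of \<open>f i0\<close> some \<open>f i\<close> is nonzero, and differentiation
  lowers the order of \<open>f i0\<close> there by one, so the two products cannot agree. A nonzero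
  Wronskian makes \<open>f\<close> and its derivative independent outside finitely many
  points.\<close>

lemma wronskian_nonzero:
  fixes f :: "nat \<Rightarrow> complex poly"
  assumes "i0 \<le> n" "degree (f i0) \<noteq> 0" "\<And>t. nonzero_pt n (\<lambda>i. poly (f i) t)"
  obtains i where "i \<le> n" "f i0 * pderiv (f i) - f i * pderiv (f i0) \<noteq> 0"
proof -
  have "\<not> constant (poly (f i0))" using assms(2) by (simp add: constant_degree)
  then obtain a where a: "poly (f i0) a = 0" using fundamental_theorem_of_algebra by blast
  obtain i where i: "i \<le> n" "poly (f i) a \<noteq> 0" using assms(3) unfolding nonzero_pt_def by blast
  have nz: "f i0 \<noteq> 0" "pderiv (f i0) \<noteq> 0" "f i \<noteq> 0"
    using assms(2) i by (auto simp: pderiv_eq_0_iff)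
  have "f i0 * pderiv (f i) \<noteq> f i * pderiv (f i0)"
  proof
    assume eq: "f i0 * pderiv (f i) = f i * pderiv (f i0)"
    have "f i * pderiv (f i0) \<noteq> 0" using nz by simp
    then have "Polynomial.order a (f i0) + Polynomial.order a (pderiv (f i)) = Polynomial.order a (f i) + Polynomial.order a (pderiv (f i0))"
      using eq by (metis order_mult)
    moreover have "Polynomial.order a (f i) = 0" using i(2) by (simp add: order_0I)
    moreover have "Polynomial.order a (f i0) = Suc (Polynomial.order a (pderiv (f i0)))"
      using order_pderiv[OF nz(1) a] .
    ultimately show False by simp
  qed
  then show thesis using that i(1) by simp
qed

lemma degree_pderiv_bound: "degree q \<le> e \<Longrightarrow> degree (pderiv q :: complex poly) \<le> e - 1"
  by (simp add: degree_pderiv)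

text \<open>All degrees are positive, so the truncated subtraction is exact.\<close>

lemma sum_degs:
  assumes "\<forall>d\<in>set ds. d \<ge> 1"
  shows "(\<Sum>l<length ds. degs ds k l - 1) + length ds = sum_list ds"
proof -
  have "degs ds k l = (degs ds k l - 1) + 1" if "l < length ds" for l
    using bspec[OF assms nth_mem[OF that]] that by (simp add: degs_def)
  then have "(\<Sum>l<length ds. degs ds k l) = (\<Sum>l<length ds. (degs ds k l - 1) + 1)"
    by (intro sum.cong) auto
  also have "\<dots> = (\<Sum>l<length ds. degs ds k l - 1) + length ds" by (simp only: sum.distrib) simp
  also have "(\<Sum>l<length ds. degs ds k l) = sum_list ds"
    by (simp add: sum_list_sum_nth degs_def lessThan_atLeast0)
  finally show ?thesis by simp
qed

text \<open>With \<open>c = length ds\<close> and \<open>d\<close> the total degree, a curve of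
  degree \<open>e \<ge> 1\<close> would satisfy
  \<open>e (d - c - 1) \<le> (e - 1) + 2 e (n - c - 1)\<close> for \<open>k > 0\<close> and
  \<open>e (d - c) \<le> (e - 1) + e + 2 e (n - c - 1)\<close> for \<open>k = 0\<close>; both
  contradict \<open>d \<ge> 2 n - c\<close>.\<close>

lemma generic_smooth_pair_no_A1_curve:
  assumes ds: "\<forall>d\<in>set ds. d \<ge> 1" and n: "n \<ge> length ds + 2"
    and d: "sum_list ds + k \<ge> 2 * n - length ds"
    and gen: "generic_in (param_space n ds k) s" and smooth: "smooth_pair n ds k s"
  shows "\<not> A1_curve n ds k s f"
proof
  assume A1: "A1_curve n ds k s f"
  define c where "c = length ds"
  define deg where "deg = degs ds k"
  \<comment> \<open>For \<open>k = 0\<close> the boundary form is a constant with vanishing Jacobian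
    row, so only the equations of \<open>X\<close> are kept.\<close>
  define p where "p = (if k = 0 then c else Suc c)"
  define H where "H = (\<lambda>l. form_eval n (deg l) (const_coeffs (s l)) f)"
  define J where "J = (\<lambda>l i. form_deriv n (deg l) (const_coeffs (s l)) i f)"
  have nz: "nonzero_pt n (\<lambda>i. poly (f i) t)"
    and X: "in_X n ds k s (\<lambda>i. poly (f i) t)" and D: "\<not> in_D n ds k s (\<lambda>i. poly (f i) t)" for t
    using A1 unfolding A1_curve_def by blast+
  have deg_c: "deg c = k" unfolding deg_def c_def degs_def by simp
  have deg_pos: "deg j \<ge> 1" if "j < p" for j
    using that ds unfolding deg_def degs_def p_def c_def by (auto split: if_splits)
  have H0: "H l = 0" if "l < c" for l
  proof -
    have "poly (H l) t = 0" for t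
      using X[of t] that unfolding H_def poly_form_eval in_X_def hom_eval_eq_form_eval c_def deg_def by blast
    then show ?thesis using poly_all_0_iff_0 by blast
  qed
  have "poly (H c) t \<noteq> 0" for t
    using X[of t] D[of t] unfolding H_def poly_form_eval deg_c in_D_def hom_eval_eq_form_eval c_def[symmetric] by blast
  \<comment> \<open>A polynomial without complex zeros is constant: the boundary equation equals
    some nonzero \<kappa> along the curve.\<close>
  then have "constant (poly (H c))" using fundamental_theorem_of_algebra by blast
  then obtain \<kappa> where \<kappa>: "H c = [:\<kappa>:]" by (metis constant_degree degree_eq_zeroE)
  have "\<kappa> \<noteq> 0" using \<open>\<And>t. poly (H c) t \<noteq> 0\<close>[of 0] \<kappa> by auto
  have pderiv_H: "pderiv (H l) = 0" if "l < p" for l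
    using that H0[of l] \<kappa> unfolding p_def by (cases "l < c") (auto simp: pderiv_pCons less_Suc_eq split: if_splits)
  have euler: "(\<Sum>i\<le>n. J l i * f i) = of_nat (deg l) * H l" for l
    unfolding J_def H_def by (rule euler_identity)

  define e where "e = Max ((\<lambda>i. degree (f i)) ` {..n})"
  have degf: "degree (f i) \<le> e" if "i \<le> n" for i unfolding e_def using that by (intro Max_ge) auto
  have "e \<in> (\<lambda>i. degree (f i)) ` {..n}" unfolding e_def by (intro Max_in) auto
  then obtain i0 where i0: "i0 \<le> n" "degree (f i0) = e" by auto
  have "e \<noteq> 0"
  proof
    assume "e = 0"
    then have "degree (f i) = 0" if "i \<le> n" for i using degf[OF that] by simp
    then have "poly (f i) t1 = poly (f i) t2" if "i \<le> n" for i t1 t2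
      using that by (metis degree_eq_zeroE mult_zero_right poly_0 poly_pCons)
    then have "\<exists>\<mu>. \<mu> \<noteq> 0 \<and> (\<forall>i\<le>n. poly (f i) t2 = \<mu> * poly (f i) t1)" for t1 t2
      by (intro exI[of _ 1]) auto
    then show False using A1 unfolding A1_curve_def by blast
  qed

  \<comment> \<open>Pairing a relation between the rows with \<open>f\<close> kills the rows of
    \<open>X\<close> by Euler's identity and leaves \<open>k \<kappa>\<close> times
    \<open>y c\<close>. Hence \<open>y c = 0\<close>, and smoothness of \<open>X\<close> handles the
    other rows.\<close>
  have full: "indep_rows p (Suc n) (\<lambda>l i. poly (J l i) t)" for t
    unfolding indep_rows_def
  proof (intro allI impI)
    fix y l assume y: "\<forall>i<Suc n. (\<Sum>l<p. y l * poly (J l i) t) = 0" and "l < p"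
    have y_c: "y c = 0" if "p = Suc c"
    proof -
      have "0 = (\<Sum>i\<le>n. (\<Sum>l<p. y l * poly (J l i) t) * poly (f i) t)" using y by simp
      also have "\<dots> = (\<Sum>l<p. y l * poly (\<Sum>i\<le>n. J l i * f i) t)"
        unfolding sum_distrib_right poly_sum poly_mult sum_distrib_left
        by (subst sum.swap) (simp add: mult_ac)
      also have "\<dots> = y c * (of_nat k * \<kappa>)"
        unfolding euler that using H0 by (simp add: \<kappa> deg_c of_nat_poly)
      finally show ?thesis using \<open>\<kappa> \<noteq> 0\<close> that unfolding p_def by (auto split: if_splits)
    qed
    have pc: "p = c \<or> p = Suc c" unfolding p_def by simp
    have "(\<Sum>l<c. y l * hom_deriv_eval n (degs ds k l) (s l) i (\<lambda>i. poly (f i) t)) = 0" if "i \<le> n" for i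
    proof -
      have "(\<Sum>l<c. y l * poly (J l i) t) = (\<Sum>l<p. y l * poly (J l i) t)" using pc y_c by auto
      then show ?thesis
        using spec[OF y, of i] that unfolding J_def poly_form_deriv hom_deriv_eval_eq_form_deriv deg_def by simp
    qed
    moreover have "jac_full_rank n ds k s c (\<lambda>i. poly (f i) t)"
      using smooth X[of t] unfolding smooth_pair_def c_def by simp
    ultimately have "\<forall>l<c. y l = 0" unfolding jac_full_rank_def by simp
    then show "y l = 0" using \<open>l < p\<close> pc y_c less_Suc_eq by auto
  qed

  \<comment> \<open>This is the limit point of the curve. For \<open>k > 0\<close> the constant
    \<open>H c\<close> has coefficient 0 at \<open>k * e\<close>, so the point lies on
    \<open>D\<close> and smoothness of \<open>D\<close> applies.\<close>
  define f_inf where "f_inf = (\<lambda>i. coeff (f i) e)"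
  have H_inf: "form_eval n (deg l) (s l) f_inf = coeff (H l) (deg l * e)" for l
    unfolding H_def f_inf_def using coeff_form_eval[of n f e] degf by simp
  have J_deg: "degree (J l i) \<le> (deg l - 1) * e"
    and J_inf: "coeff (J l i) ((deg l - 1) * e) = form_deriv n (deg l) (s l) i f_inf" for l i
    unfolding J_def f_inf_def using form_deriv_bounds[of n f e] degf by auto
  have "f_inf i0 \<noteq> 0" using i0 \<open>e \<noteq> 0\<close> unfolding f_inf_def by auto
  then have X_inf: "in_X n ds k s f_inf"
    unfolding in_X_def nonzero_pt_def hom_eval_eq_form_eval
    using i0(1) H_inf H0 by (auto simp: deg_def[symmetric] c_def[symmetric])
  have jac_inf: "jac_full_rank n ds k s p f_inf"
  proof (cases "k = 0")
    case True
    then show ?thesis using smooth X_inf unfolding smooth_pair_def p_def c_def by simp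
  next
    case False
    have "coeff (H c) (deg c * e) = 0"
      unfolding \<kappa> deg_c using False \<open>e \<noteq> 0\<close> by (simp add: coeff_eq_0)
    then have "in_D n ds k s f_inf"
      using X_inf H_inf[of c] unfolding in_D_def hom_eval_eq_form_eval c_def[symmetric] deg_c by simp
    then show ?thesis using smooth False unfolding smooth_pair_def p_def c_def by simp
  qed
  have inf: "indep_rows p (Suc n) (\<lambda>l i. coeff (J l i) ((deg l - 1) * e))"
    unfolding J_inf using jac_inf
    unfolding indep_rows_def jac_full_rank_def hom_deriv_eval_eq_form_deriv deg_def less_Suc_eq_le .

  \<comment> \<open>The deformations that \<open>lifts_kernel\<close> requires; their degree is at
    most \<open>e\<close> because \<delta> acts on coefficients.\<close>
  have "\<exists>g. (\<forall>i\<le>n. degree (g i) \<le> e) \<and>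
      (\<forall>l<p. (\<Sum>i\<le>n. J l i * g i) = (if l = j then - mono_eval n f \<alpha> else 0))"
    if j: "j < p" and \<alpha>: "\<alpha> \<in> monoms n (deg j)" for j \<alpha>
  proof -
    have "j \<le> length ds" using j unfolding p_def c_def by (auto split: if_splits)
    then obtain \<delta> where "derivation \<delta> \<and> (\<forall>l. map_poly \<delta> (H l) =
        (if l = j then mono_eval n f \<alpha> else 0) + (\<Sum>i\<le>n. J l i * map_poly \<delta> (f i)))"
      using first_order_deformation[OF gen _ \<alpha>[unfolded deg_def], of f]
      unfolding H_def J_def deg_def by (elim meta_impE exE)
    then have \<delta>: "derivation \<delta>" "\<And>l. map_poly \<delta> (H l) =
        (if l = j then mono_eval n f \<alpha> else 0) + (\<Sum>i\<le>n. J l i * map_poly \<delta> (f i))"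
      by simp_all
    \<comment> \<open>the Euler field absorbs the variation of the constant value of the boundary equation\<close>
    define \<gamma> where "\<gamma> = \<delta> \<kappa> / (of_nat k * \<kappa>)"
    define g where "g = (\<lambda>i. map_poly \<delta> (f i) - [:\<gamma>:] * f i)"
    have "degree (g i) \<le> e" if "i \<le> n" for i
      unfolding g_def using degf[OF that]
      by (intro degree_diff_le order.trans[OF degree_map_poly_derivation[OF \<delta>(1)]]) (auto intro: order.trans[OF degree_smult_le])
    moreover have "(\<Sum>i\<le>n. J l i * g i) = (if l = j then - mono_eval n f \<alpha> else 0)" if "l < p" for l
    proof -
      have "(\<Sum>i\<le>n. J l i * g i) = (\<Sum>i\<le>n. J l i * map_poly \<delta> (f i)) - [:\<gamma>:] * (\<Sum>i\<le>n. J l i * f i)"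
        unfolding g_def sum_distrib_left right_diff_distrib sum_subtractf by (simp add: mult_ac)
      also have "\<dots> = map_poly \<delta> (H l) - [:\<gamma>:] * (of_nat (deg l) * H l) -
          (if l = j then mono_eval n f \<alpha> else 0)"
        unfolding euler \<delta>(2) by simp
      also have "map_poly \<delta> (H l) - [:\<gamma>:] * (of_nat (deg l) * H l) = 0"
      proof (cases "l < c")
        case False
        then have "l = c" "k \<noteq> 0" using that unfolding p_def by (auto split: if_splits)
        then show ?thesis using \<open>\<kappa> \<noteq> 0\<close>
          by (simp add: \<kappa> deg_c \<gamma>_def of_nat_poly map_poly_pCons derivation_0[OF \<delta>(1)])
      qed (simp add: H0)
      finally show ?thesis by simp
    qed
    ultimately show ?thesis by blast
  qed
  then have "\<exists>G. \<forall>j \<alpha>. j < p \<longrightarrow> \<alpha> \<in> monoms n (deg j) \<longrightarrow> (\<forall>i\<le>n. degree (G j \<alpha> i) \<le> e) \<and>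
      (\<forall>l<p. (\<Sum>i\<le>n. J l i * G j \<alpha> i) = (if l = j then - mono_eval n f \<alpha> else 0))"
    by (intro choice allI) auto
  then obtain G where G: "\<And>j \<alpha> i. j < p \<Longrightarrow> \<alpha> \<in> monoms n (deg j) \<Longrightarrow> i \<le> n \<Longrightarrow> degree (G j \<alpha> i) \<le> e"
      "\<And>l j \<alpha>. l < p \<Longrightarrow> j < p \<Longrightarrow> \<alpha> \<in> monoms n (deg j) \<Longrightarrow>
        (\<Sum>i\<le>n. J l i * G j \<alpha> i) = (if l = j then - mono_eval n f \<alpha> else 0)"
    by blast
  have ext: "\<exists>u. (\<forall>i<Suc n. degree (u i) \<le> 2 * e) \<and> (\<forall>l<p. (\<Sum>i<Suc n. J l i * u i) = 0) \<and>
      (\<forall>i<Suc n. poly (u i) t = x i)"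
    if x: "\<And>l. l < p \<Longrightarrow> (\<Sum>i<Suc n. poly (J l i) t * x i) = 0" for t x
  proof -
    obtain b where "b \<le> n" "poly (f b) t \<noteq> 0" using nz[of t] unfolding nonzero_pt_def by blast
    then have "kernel_lift n e p J t x"
      using lifts_kernel[of J n deg s f p e G b t x] deg_pos degf G x
      unfolding J_def lessThan_Suc_atMost by blast
    then show ?thesis unfolding kernel_lift_def lessThan_Suc_atMost less_Suc_eq_le .
  qed

  \<comment> \<open>Obtained by differentiating the constant functions \<open>H l\<close> along the
    curve.\<close>
  have Jf': "(\<Sum>i\<le>n. J l i * pderiv (f i)) = 0" if "l < p" for l
    using derivation_form_eval[OF derivation_pderiv, of n "deg l" "const_coeffs (s l)" f] pderiv_H[OF that]
    unfolding H_def J_def by (simp add: pderiv_pCons)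
  define r where "r = Suc n - p"
  have "2 \<le> r" using n unfolding r_def p_def c_def by (cases "k = 0"; simp; linarith)
  have N: "Suc n = p + r" using n unfolding r_def p_def c_def by (simp split: if_splits)
  have sum_p: "(\<Sum>l<p. deg l - 1) + p = sum_list ds + k"
    using sum_degs[OF ds, of k] deg_c unfolding p_def deg_def[symmetric] c_def[symmetric] by auto
  show False
  proof (cases "k = 0")
    case False
    \<comment> \<open>The only prescribed column is the derivative of \<open>f\<close>, of degree at
      most \<open>e - 1\<close>; this drop by one is what yields the contradiction.\<close>
    have "(\<Sum>l<p. (deg l - 1) * e) \<le> (\<Sum>j<(1::nat). e - 1) + (r - 1) * (2 * e)"
    proof (rule kernel_degree_bound[where N = "Suc n" and J = J and W = "\<lambda>j i. pderiv (f i)"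
          and g = "pderiv (f i0)", OF N _ _ full inf])
      show "degree (J l i) \<le> (deg l - 1) * e" for l i by (rule J_deg)
      show "1 \<le> r" using \<open>2 \<le> r\<close> by simp
      show "pderiv (f i0) \<noteq> 0" using i0 \<open>e \<noteq> 0\<close> by (simp add: pderiv_eq_0_iff)
      show "(\<Sum>i<Suc n. J l i * pderiv (f i)) = 0" if "l < p" for l
        unfolding lessThan_Suc_atMost by (rule Jf'[OF that])
      show "degree (pderiv (f i)) \<le> e - 1" if "i < Suc n" for i
        using degf[of i] that by (intro degree_pderiv_bound) simp
      show "indep_rows 1 (Suc n) (\<lambda>j i. poly (pderiv (f i)) t)" if "poly (pderiv (f i0)) t \<noteq> 0" for t
        using that i0(1) unfolding indep_rows_def by (auto dest!: spec[of _ i0])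
    qed (use ext in blast)
    moreover have "(\<Sum>l<p. deg l - 1) \<ge> 2 * (r - 1) + 1"
      using sum_p d n False unfolding r_def p_def c_def by simp
    then have "(2 * (r - 1) + 1) * e \<le> (\<Sum>l<p. (deg l - 1) * e)"
      unfolding sum_distrib_right[symmetric] by (rule mult_le_mono1)
    ultimately show False using \<open>e \<noteq> 0\<close> by (simp add: algebra_simps)
  next
    case True
    obtain i1 where i1: "i1 \<le> n" "f i0 * pderiv (f i1) - f i1 * pderiv (f i0) \<noteq> 0"
      using wronskian_nonzero[OF i0(1) _ nz] i0(2) \<open>e \<noteq> 0\<close> by metis
    \<comment> \<open>For \<open>k = 0\<close> all \<open>H l\<close> with \<open>l < p\<close>
      vanish, so by Euler's identity \<open>f\<close> itself is a second kernel column.\<close>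
    define W where "W = (\<lambda>(j::nat) i. if j = 0 then pderiv (f i) else f i)"
    have "(\<Sum>l<p. (deg l - 1) * e) \<le> (\<Sum>j<2. if j = (0::nat) then e - 1 else e) + (r - 2) * (2 * e)"
    proof (rule kernel_degree_bound[where N = "Suc n" and J = J and W = W
          and g = "f i0 * pderiv (f i1) - f i1 * pderiv (f i0)", OF N _ _ full inf _ _ i1(2)])
      show "degree (J l i) \<le> (deg l - 1) * e" for l i by (rule J_deg)
      show "2 \<le> r" by fact
      show "(\<Sum>i<Suc n. J l i * W j i) = 0" if "l < p" for l j
        unfolding lessThan_Suc_atMost W_def using Jf'[OF that] euler[of l] H0[of l] that True
        by (cases "j = 0") (auto simp: p_def)
      show "degree (W j i) \<le> (if j = 0 then e - 1 else e)" if "i < Suc n" for i j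
        unfolding W_def using degf[of i] degree_pderiv_bound[of "f i" e] that by simp
      show "indep_rows 2 (Suc n) (\<lambda>j i. poly (W j i) t)"
        if t: "poly (f i0 * pderiv (f i1) - f i1 * pderiv (f i0)) t \<noteq> 0" for t
        unfolding indep_rows_def
      proof (intro allI impI)
        fix y :: "nat \<Rightarrow> complex" and l :: nat
        assume y: "\<forall>i<Suc n. (\<Sum>j<2. y j * poly (W j i) t) = 0" and "l < 2"
        define D where "D = poly (f i0 * pderiv (f i1) - f i1 * pderiv (f i0)) t"
        have y': "y 0 * poly (pderiv (f i)) t + y 1 * poly (f i) t = 0" if "i \<le> n" for i
          using y that by (simp add: W_def numeral_2_eq_2)
        \<comment> \<open>Cramer's rule for the derivative of \<open>f\<close> and \<open>f\<close>
          at the indices \<open>i0\<close> and \<open>i1\<close>, with the Wronskian as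
          determinant.\<close>
        have "y 0 * D = poly (f i0) t * (y 0 * poly (pderiv (f i1)) t + y 1 * poly (f i1) t) -
            poly (f i1) t * (y 0 * poly (pderiv (f i0)) t + y 1 * poly (f i0) t)"
          unfolding D_def by (simp add: algebra_simps)
        then have "y 0 * D = 0" using y'[OF i0(1)] y'[OF i1(1)] by simp
        moreover have "y 1 * D = poly (pderiv (f i1)) t * (y 0 * poly (pderiv (f i0)) t + y 1 * poly (f i0) t) -
            poly (pderiv (f i0)) t * (y 0 * poly (pderiv (f i1)) t + y 1 * poly (f i1) t)"
          unfolding D_def by (simp add: algebra_simps)
        then have "y 1 * D = 0" using y'[OF i0(1)] y'[OF i1(1)] by simp
        ultimately show "y l = 0" using t \<open>l < 2\<close> unfolding D_def[symmetric] by (auto simp: less_2_cases_iff)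
      qed
    qed (use ext in blast)
    moreover have "(\<Sum>l<p. deg l - 1) \<ge> 2 * (r - 2) + 2"
      using sum_p d n True unfolding r_def p_def c_def by simp
    then have "(2 * (r - 2) + 2) * e \<le> (\<Sum>l<p. (deg l - 1) * e)"
      unfolding sum_distrib_right[symmetric] by (rule mult_le_mono1)
    ultimately show False using \<open>e \<noteq> 0\<close> by (simp add: numeral_2_eq_2 algebra_simps)
  qed
qed

theorem mainTheorem1:
  fixes n :: nat and ds :: "nat list" and k :: nat
  assumes "length ds \<ge> 1"
    and "\<forall>d\<in>set ds. d \<ge> 1"
    and "n \<ge> length ds + 2"
    and "sum_list ds + k \<ge> 2 * n - length ds"
  shows "\<exists>\<Z>. countable \<Z> \<and>
           (\<forall>Z\<in>\<Z>. zariski_closed_in (param_space n ds k) Z \<and> Z \<noteq> param_space n ds k) \<and>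
           (\<forall>s\<in>param_space n ds k. smooth_pair n ds k s \<longrightarrow> s \<notin> \<Union>\<Z> \<longrightarrow>
              \<not> (\<exists>f. A1_curve n ds k s f))"
proof -
  obtain \<Z> where "countable \<Z>"
    and "\<forall>Z\<in>\<Z>. zariski_closed_in (param_space n ds k) Z \<and> Z \<noteq> param_space n ds k"
    and \<Z>: "\<forall>s\<in>param_space n ds k. s \<notin> \<Union>\<Z> \<longrightarrow> generic_in (param_space n ds k) s"
    using nongeneric_countable_closed[of "param_space n ds k"] by (elim exE conjE)
  moreover have "\<not> (\<exists>f. A1_curve n ds k s f)"
    if "s \<in> param_space n ds k" "smooth_pair n ds k s" "s \<notin> \<Union>\<Z>" for s
  proof -
    have "generic_in (param_space n ds k) s" by (rule mp[OF bspec[OF \<Z> that(1)] that(3)])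
    then show ?thesis using generic_smooth_pair_no_A1_curve[OF assms(2-4) _ that(2)] by simp
  qed
  ultimately show ?thesis by (intro exI[of _ \<Z>] conjI ballI impI) simp_all
qed

end
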